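(* Let $G$ be a finite simple graph embedded in a closed surface and let $\mathcal F\neq\mathcal F(G)$ be a set of even faces of $G$. Then the Zhang–Zhang polynomial $\mathbf{ZZ}_{\mathcal F}(G,x)$ of $G$ with respect to $\mathcal F$ equals the cube polynomial $\mathbf C(R(G;\mathcal F),x)$ of the resonance graph $R(G;\mathcal F)$.
   Context: A closed surface is a compact connected 2-dimensional manifold without boundary. A face of $G$ is the closure of a connected component of $\Sigma\setminus G$; $E(f)$ denotes the set of edges on the boundary of face $f$, and $\mathcal F(G)$ denotes the set of all faces of $G$. A face is even if its boundary is a cycle of even length. For a set $\mathcal F$ of even faces, the resonance graph $R(G;\mathcal F)$ has as vertex set the set of all perfect matchings of $G$, and two perfect matchings $M_1,M_2$ are adjacent iff $M_1\oplus M_2=E(f)$ for some face $f\in\mathcal F$. A Clar cover of $G$ is a spanning subgraph $S$ of $G$ each of whose connected components is either a single edge or the boundary cycle of an even face. The Zhang–Zhang polynomial is $\mathbf{ZZ}_{\mathcal F}(G,x)=\sum_{k\ge0} z_k(G,\mathcal F)x^k$, where $z_k(G,\mathcal F)$ is the number of Clar covers of $G$ having exactly $k$ face-boundary components, all of which are boundaries of faces in $\mathcal F$. The cube polynomial of a graph $H$ is $\mathbf C(H,x)=\sum_{i\ge0}\alpha_i(H)x^i$, where $\alpha_i(H)$ is the number of induced subgraphs of $H$ isomorphic to the $i$-dimensional hypercube $Q_i$ ($Q_0$ being the one-vertex graph). *)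

theory Defs
  imports "HOL-Analysis.Analysis" "HOL-Computational_Algebra.Polynomial"
begin

section \<open>Graphs\<close>

type_synonym 'v ugraph = "'v set \<times> 'v set set"

abbreviation gverts :: "'v ugraph \<Rightarrow> 'v set" where "gverts \<equiv> fst"
abbreviation gedges :: "'v ugraph \<Rightarrow> 'v set set" where "gedges \<equiv> snd"

definition finite_simple_graph :: "'v ugraph \<Rightarrow> bool" where
  "finite_simple_graph G \<longleftrightarrow>
     finite (gverts G) \<and> (\<forall>e\<in>gedges G. e \<subseteq> gverts G \<and> card e = 2)"

definition subgraph_of :: "'v ugraph \<Rightarrow> 'v ugraph \<Rightarrow> bool" where
  "subgraph_of H G \<longleftrightarrow>
     gverts H \<subseteq> gverts G \<and> gedges H \<subseteq> gedges G \<and> (\<forall>e\<in>gedges H. e \<subseteq> gverts H)"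

definition induced_subgraph_on :: "'v ugraph \<Rightarrow> 'v set \<Rightarrow> 'v ugraph" where
  "induced_subgraph_on G W = (W, {e \<in> gedges G. e \<subseteq> W})"

definition graph_isomorphic :: "'v ugraph \<Rightarrow> 'w ugraph \<Rightarrow> bool" where
  "graph_isomorphic G H \<longleftrightarrow>
     (\<exists>h. bij_betw h (gverts G) (gverts H) \<and>
          (\<forall>u\<in>gverts G. \<forall>v\<in>gverts G. {u, v} \<in> gedges G \<longleftrightarrow> {h u, h v} \<in> gedges H))"

definition reachable_in :: "'v ugraph \<Rightarrow> 'v \<Rightarrow> 'v \<Rightarrow> bool" where
  "reachable_in G u v \<longleftrightarrow> (u, v) \<in> {(x, y). {x, y} \<in> gedges G}\<^sup>*"

definition graph_components :: "'v ugraph \<Rightarrow> 'v ugraph set" where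
  "graph_components G =
     (\<lambda>u. induced_subgraph_on G {v \<in> gverts G. reachable_in G u v}) ` gverts G"

definition is_cycle :: "'v ugraph \<Rightarrow> bool" where
  "is_cycle C \<longleftrightarrow>
     (\<exists>vs. length vs \<ge> 3 \<and> distinct vs \<and>
           C = (set vs, {{vs ! i, vs ! (Suc i mod length vs)} | i. i < length vs}))"

definition perfect_matching :: "'v ugraph \<Rightarrow> 'v set set \<Rightarrow> bool" where
  "perfect_matching G M \<longleftrightarrow> M \<subseteq> gedges G \<and> (\<forall>v\<in>gverts G. \<exists>!e. e \<in> M \<and> v \<in> e)"


section \<open>Cube polynomial\<close>

definition hypercube :: "nat \<Rightarrow> bool list ugraph" where
  "hypercube n =
     ({xs. length xs = n},
      {{xs, ys} | xs ys. length xs = n \<and> length ys = n \<and> card {i. i < n \<and> xs ! i \<noteq> ys ! i} = 1})"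

definition induced_cube_count :: "'v ugraph \<Rightarrow> nat \<Rightarrow> nat" where
  "induced_cube_count H i =
     card {K. (\<exists>W\<subseteq>gverts H. K = induced_subgraph_on H W) \<and> graph_isomorphic K (hypercube i)}"

text \<open>The formal sums over all indices are taken over their support, which is finite for finite graphs.\<close>

definition cube_polynomial :: "'v ugraph \<Rightarrow> int poly" where
  "cube_polynomial H =
     (\<Sum>i | induced_cube_count H i \<noteq> 0. monom (int (induced_cube_count H i)) i)"


section \<open>Graphs embedded in closed surfaces\<close>

definition closed_surface :: "'a topology \<Rightarrow> bool" where
  "closed_surface X \<longleftrightarrow>
     topspace X \<noteq> {} \<and> compact_space X \<and> connected_space X \<and>
     Hausdorff_space X \<and> second_countable X \<and>
     (\<forall>x\<in>topspace X. \<exists>U. openin X U \<and> x \<in> U \<and>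
        subtopology X U homeomorphic_space (euclidean :: (real^2) topology))"

text \<open>
  A vertex \<open>v\<close> is drawn as the point \<open>p v\<close>, an edge \<open>e\<close> as the arc \<open>\<gamma> e\<close> parametrised by the
  unit interval. The embedding need not be cellular.
\<close>

definition embedded_in ::
    "'a topology \<Rightarrow> 'v ugraph \<Rightarrow> ('v \<Rightarrow> 'a) \<Rightarrow> ('v set \<Rightarrow> real \<Rightarrow> 'a) \<Rightarrow> bool" where
  "embedded_in X G p \<gamma> \<longleftrightarrow>
     p ` gverts G \<subseteq> topspace X \<and> inj_on p (gverts G) \<and>
     (\<forall>e\<in>gedges G. pathin X (\<gamma> e) \<and> inj_on (\<gamma> e) {0..1} \<and> {\<gamma> e 0, \<gamma> e 1} = p ` e \<and>
        \<gamma> e ` {0<..<1} \<inter> p ` gverts G = {}) \<and>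
     (\<forall>e\<in>gedges G. \<forall>e'\<in>gedges G. e \<noteq> e' \<longrightarrow> \<gamma> e ` {0<..<1} \<inter> \<gamma> e' ` {0<..<1} = {})"

definition drawing :: "('v \<Rightarrow> 'a) \<Rightarrow> ('v set \<Rightarrow> real \<Rightarrow> 'a) \<Rightarrow> 'v ugraph \<Rightarrow> 'a set" where
  "drawing p \<gamma> H = p ` gverts H \<union> (\<Union>e\<in>gedges H. \<gamma> e ` {0..1})"

definition open_regions ::
    "'a topology \<Rightarrow> 'v ugraph \<Rightarrow> ('v \<Rightarrow> 'a) \<Rightarrow> ('v set \<Rightarrow> real \<Rightarrow> 'a) \<Rightarrow> 'a set set" where
  "open_regions X G p \<gamma> =
     connected_components_of (subtopology X (topspace X - drawing p \<gamma> G))"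

definition faces ::
    "'a topology \<Rightarrow> 'v ugraph \<Rightarrow> ('v \<Rightarrow> 'a) \<Rightarrow> ('v set \<Rightarrow> real \<Rightarrow> 'a) \<Rightarrow> 'a set set" where
  "faces X G p \<gamma> = (\<lambda>c. X closure_of c) ` open_regions X G p \<gamma>"

text \<open>
  The boundary of a face is the frontier of the open region \<open>c\<close> whose closure it is, not the
  frontier of the closed set \<open>f\<close>: an edge with the same region on both sides lies on the
  boundary although it is interior to \<open>f\<close>. Distinct regions are disjoint open sets, so they have
  distinct closures and the union below has exactly one member.
\<close>

definition face_boundary ::
    "'a topology \<Rightarrow> 'v ugraph \<Rightarrow> ('v \<Rightarrow> 'a) \<Rightarrow> ('v set \<Rightarrow> real \<Rightarrow> 'a) \<Rightarrow> 'a set \<Rightarrow> 'a set" where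
  "face_boundary X G p \<gamma> f =
     \<Union>{X frontier_of c | c. c \<in> open_regions X G p \<gamma> \<and> X closure_of c = f}"

definition boundary_edges ::
    "'a topology \<Rightarrow> 'v ugraph \<Rightarrow> ('v \<Rightarrow> 'a) \<Rightarrow> ('v set \<Rightarrow> real \<Rightarrow> 'a) \<Rightarrow> 'a set \<Rightarrow> 'v set set" where
  "boundary_edges X G p \<gamma> f = {e \<in> gedges G. \<gamma> e ` {0..1} \<subseteq> face_boundary X G p \<gamma> f}"

definition is_boundary_cycle ::
    "'a topology \<Rightarrow> 'v ugraph \<Rightarrow> ('v \<Rightarrow> 'a) \<Rightarrow> ('v set \<Rightarrow> real \<Rightarrow> 'a) \<Rightarrow> 'v ugraph \<Rightarrow> 'a set \<Rightarrow> bool" where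
  "is_boundary_cycle X G p \<gamma> C f \<longleftrightarrow>
     subgraph_of C G \<and> is_cycle C \<and> drawing p \<gamma> C = face_boundary X G p \<gamma> f"

definition even_face ::
    "'a topology \<Rightarrow> 'v ugraph \<Rightarrow> ('v \<Rightarrow> 'a) \<Rightarrow> ('v set \<Rightarrow> real \<Rightarrow> 'a) \<Rightarrow> 'a set \<Rightarrow> bool" where
  "even_face X G p \<gamma> f \<longleftrightarrow>
     f \<in> faces X G p \<gamma> \<and> (\<exists>C. is_boundary_cycle X G p \<gamma> C f \<and> even (card (gedges C)))"


section \<open>Resonance graph and Zhang--Zhang polynomial\<close>

definition resonance_graph ::
    "'a topology \<Rightarrow> 'v ugraph \<Rightarrow> ('v \<Rightarrow> 'a) \<Rightarrow> ('v set \<Rightarrow> real \<Rightarrow> 'a) \<Rightarrow> 'a set set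
      \<Rightarrow> 'v set set ugraph" where
  "resonance_graph X G p \<gamma> F =
     ({M. perfect_matching G M},
      {{M1, M2} | M1 M2. perfect_matching G M1 \<and> perfect_matching G M2 \<and>
         (\<exists>f\<in>F. sym_diff M1 M2 = boundary_edges X G p \<gamma> f)})"

definition face_boundary_components ::
    "'a topology \<Rightarrow> 'v ugraph \<Rightarrow> ('v \<Rightarrow> 'a) \<Rightarrow> ('v set \<Rightarrow> real \<Rightarrow> 'a) \<Rightarrow> 'v ugraph
      \<Rightarrow> 'v ugraph set" where
  "face_boundary_components X G p \<gamma> S =
     {C \<in> graph_components S. \<exists>f. even_face X G p \<gamma> f \<and> is_boundary_cycle X G p \<gamma> C f}"

definition clar_cover ::
    "'a topology \<Rightarrow> 'v ugraph \<Rightarrow> ('v \<Rightarrow> 'a) \<Rightarrow> ('v set \<Rightarrow> real \<Rightarrow> 'a) \<Rightarrow> 'v ugraph \<Rightarrow> bool" where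
  "clar_cover X G p \<gamma> S \<longleftrightarrow>
     subgraph_of S G \<and> gverts S = gverts G \<and>
     (\<forall>C\<in>graph_components S.
        (\<exists>e\<in>gedges G. C = (e, {e})) \<or> C \<in> face_boundary_components X G p \<gamma> S)"

definition clar_cover_count ::
    "'a topology \<Rightarrow> 'v ugraph \<Rightarrow> ('v \<Rightarrow> 'a) \<Rightarrow> ('v set \<Rightarrow> real \<Rightarrow> 'a) \<Rightarrow> 'a set set \<Rightarrow> nat \<Rightarrow> nat" where
  "clar_cover_count X G p \<gamma> F k =
     card {S. clar_cover X G p \<gamma> S \<and> card (face_boundary_components X G p \<gamma> S) = k \<and>
              (\<forall>C\<in>face_boundary_components X G p \<gamma> S. \<exists>f\<in>F. is_boundary_cycle X G p \<gamma> C f)}"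

definition zz_polynomial ::
    "'a topology \<Rightarrow> 'v ugraph \<Rightarrow> ('v \<Rightarrow> 'a) \<Rightarrow> ('v set \<Rightarrow> real \<Rightarrow> 'a) \<Rightarrow> 'a set set \<Rightarrow> int poly" where
  "zz_polynomial X G p \<gamma> F =
     (\<Sum>k | clar_cover_count X G p \<gamma> F k \<noteq> 0. monom (int (clar_cover_count X G p \<gamma> F k)) k)"

end

theory Submission
  imports Defs
begin

text \<open>
  A Clar cover \<open>S\<close> corresponds to the set of all perfect matchings of \<open>G\<close> contained in \<open>S\<close>: switching the
  matching on each of its \<open>k\<close> face cycles independently gives an induced \<open>k\<close>-cube of the resonance graph,
  and \<open>S\<close> is recovered as the union of these matchings. Conversely, every induced cube arises in this way
  as soon as opposite edges of each of its squares carry the same face boundary, for then the two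
  boundaries in a square are alternating for adjacent matchings and hence disjoint. Otherwise a square
  yields four faces in \<open>F\<close> with distinct boundaries whose sum modulo 2 vanishes, so that every edge on
  them lies on at least two of them. As an arc in a surface is locally two-sided, the union of these
  closed faces is then open, so they are all the faces of \<open>G\<close>, contradicting that \<open>F\<close> is proper.
\<close>

section \<open>Circuits\<close>

text \<open>The counting never sees the surface. Each face is replaced by the edge set of its
  boundary, since adjacency of matchings and Clar covers depend on nothing else, and the fact that
  \<open>F\<close> is proper enters through one exclusion: no four distinct boundaries split into
  two pairs with equal symmetric difference. The number four is the length of a square. Going round
  it, consecutive boundaries differ because opposite corners are different matchings; if opposite
  boundaries differed too, all four would be distinct. The embedding need not be cellular, and one
  region may lie on both sides of an edge, so no Euler formula or rotation system is available. The
  topological part therefore argues with open regions and charts only: at an inner point of an edge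
  there are at most two local sides, and at a vertex a punctured disc is connected.\<close>

text \<open>The edge set of an even cycle, in the form in which it is used: degree two,
  connectedness (a nonempty set of edges closed under touching is everything), and one perfect
  matching of the cycle in place of even length. The vertices are the union of the edges.\<close>

definition circuit :: "'v set set \<Rightarrow> bool" where
  "circuit C \<longleftrightarrow> C \<noteq> {} \<and> (\<forall>v\<in>\<Union>C. card {e\<in>C. v \<in> e} = 2) \<and>
     (\<forall>P\<subseteq>C. P \<noteq> {} \<longrightarrow> (\<forall>e\<in>P. \<forall>e'\<in>C. e \<inter> e' \<noteq> {} \<longrightarrow> e' \<in> P) \<longrightarrow> P = C) \<and>
     (\<exists>A\<subseteq>C. \<forall>v\<in>\<Union>C. \<exists>!e. e \<in> A \<and> v \<in> e)"

lemma circuit_degree: "circuit C \<Longrightarrow> v \<in> \<Union>C \<Longrightarrow> card {e\<in>C. v \<in> e} = 2"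
  unfolding circuit_def by blast

lemma not_circuit_singleton: "v \<in> e \<Longrightarrow> \<not> circuit {e}"
proof
  assume v: "v \<in> e" and C: "circuit {e}"
  have "{x\<in>{e}. v \<in> x} = {e}" using v by auto
  then show False using circuit_degree[OF C, of v] v by simp
qed

lemma circuit_connected:
  assumes "circuit C" "P \<subseteq> C" "P \<noteq> {}"
    and "\<And>e e'. e \<in> P \<Longrightarrow> e' \<in> C \<Longrightarrow> e \<inter> e' \<noteq> {} \<Longrightarrow> e' \<in> P"
  shows "P = C"
proof -
  have "\<forall>P\<subseteq>C. P \<noteq> {} \<longrightarrow> (\<forall>e\<in>P. \<forall>e'\<in>C. e \<inter> e' \<noteq> {} \<longrightarrow> e' \<in> P) \<longrightarrow> P = C"
    using assms(1) unfolding circuit_def by (elim conjE)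
  then show ?thesis using assms(2-4) by simp
qed

lemma circuit_other_edge:
  assumes "circuit C" "e \<in> C" "v \<in> e"
  obtains e' where "e' \<noteq> e" "{x\<in>C. v \<in> x} = {e, e'}"
proof -
  have "card {x\<in>C. v \<in> x} = 2" using circuit_degree[OF assms(1)] assms by blast
  then obtain a b where "a \<noteq> b" "{x\<in>C. v \<in> x} = {a, b}" by (meson card_2_iff)
  moreover have "e \<in> {x\<in>C. v \<in> x}" using assms by blast
  ultimately show thesis using that[of a] that[of b] by (metis insert_commute insert_iff singletonD)
qed

text \<open>All three properties are read off from the fact that a position lies on exactly the edge
  leaving it and the edge arriving at it. The matching consists of the edges with even index, which
  alternate consistently across the wrap-around because the length is even.\<close>

lemma cycle_edges_circuit:
  assumes "is_cycle C" "even (card (gedges C))"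
  shows "circuit (gedges C)" "gverts C = \<Union>(gedges C)"
proof -
  obtain vs where n3: "length vs \<ge> 3" and dist: "distinct vs"
    and C: "C = (set vs, {{vs ! i, vs ! (Suc i mod length vs)} | i. i < length vs})"
    using assms(1) unfolding is_cycle_def by blast
  define n where "n = length vs"
  define e where "e i = {vs ! i, vs ! (Suc i mod n)}" for i
  have n3: "n \<ge> 3" using n3 n_def by simp
  have E: "gedges C = e ` {..<n}" unfolding C e_def n_def by auto
  have sm: "Suc i mod n = (if Suc i = n then 0 else Suc i)" if "i < n" for i using that by auto
  have memb: "vs ! j \<in> e i \<longleftrightarrow> j = i \<or> j = Suc i mod n" if "i < n" "j < n" for i j
  proof -
    have "Suc i mod n < n" using n3 by simp
    then show ?thesis unfolding e_def using that dist by (auto simp: nth_eq_iff_index_eq n_def)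
  qed
  \<comment> \<open>Two different indices with the same edge would be cyclic successors of each
    other, which happens only for length two.\<close>
  have inj: "inj_on e {..<n}"
  proof (rule inj_onI)
    fix i j assume ij: "i \<in> {..<n}" "j \<in> {..<n}" "e i = e j"
    have "vs ! i \<in> e j" "vs ! j \<in> e i" using ij unfolding e_def by blast+
    then have "i = j \<or> i = Suc j mod n" "j = i \<or> j = Suc i mod n"
      using memb[of j i] memb[of i j] ij(1,2) by blast+
    then show "i = j" using ij(1,2) n3 by (auto simp: sm split: if_splits)
  qed
  have cn: "card (gedges C) = n" unfolding E using inj by (simp add: card_image)
  have evn: "even n" using assms(2) cn by simp
  have vsE: "\<Union>(gedges C) = set vs"
  proof
    have "e i \<subseteq> set vs" if "i < n" for i
    proof -
      have "Suc i mod n < n" using n3 by simp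
      then show ?thesis using that unfolding e_def n_def by simp
    qed
    then show "\<Union>(gedges C) \<subseteq> set vs" unfolding E by blast
    show "set vs \<subseteq> \<Union>(gedges C)"
    proof
      fix v assume "v \<in> set vs"
      then obtain j where "j < n" "v = vs ! j" unfolding in_set_conv_nth n_def by blast
      then show "v \<in> \<Union>(gedges C)" unfolding E e_def by blast
    qed
  qed
  have "gverts C = set vs" by (simp add: C)
  then show "gverts C = \<Union>(gedges C)" using vsE by (rule trans[OF _ sym])
  have at: "\<exists>j k. j < n \<and> k < n \<and> v = vs ! j \<and> j = Suc k mod n \<and> j \<noteq> k \<and> (even j \<longleftrightarrow> odd k) \<and>
       (\<forall>i<n. v \<in> e i \<longleftrightarrow> i = j \<or> i = k)" if v: "v \<in> set vs" for v
  proof -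
    obtain j where j: "j < n" "v = vs ! j" using v by (auto simp: in_set_conv_nth n_def)
    \<comment> \<open>The cyclic predecessor of \<open>j\<close>. Its parity is opposite to that of
      \<open>j\<close> even for \<open>j = 0\<close>, because \<open>n - 1\<close> is odd.\<close>
    define k where "k = (if j = 0 then n - 1 else j - 1)"
    have "k < n" "j = Suc k mod n" "j \<noteq> k" "even j \<longleftrightarrow> odd k" using j n3 evn by (auto simp: k_def)
    moreover have "\<forall>i<n. v \<in> e i \<longleftrightarrow> i = j \<or> i = k"
      using j \<open>k < n\<close> \<open>j = Suc k mod n\<close> memb n3 by (auto simp: sm split: if_splits)
    ultimately show ?thesis using j by blast
  qed
  show "circuit (gedges C)" unfolding circuit_def
  proof (intro conjI ballI allI impI)
    show "gedges C \<noteq> {}" unfolding E using n3 by (auto simp: lessThan_empty_iff)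
    show "card {x \<in> gedges C. v \<in> x} = 2" if v: "v \<in> \<Union>(gedges C)" for v
    proof -
      obtain j k where jk: "j < n" "k < n" "j \<noteq> k" "\<forall>i<n. v \<in> e i \<longleftrightarrow> i = j \<or> i = k"
        using at[OF v[unfolded vsE]] by meson
      have "{x \<in> gedges C. v \<in> x} = {e j, e k}" using jk unfolding E by auto
      moreover have "e j \<noteq> e k" using inj jk by (auto dest: inj_onD)
      ultimately show ?thesis by simp
    qed
    show "P = gedges C" if P: "P \<subseteq> gedges C" "P \<noteq> {}"
      "\<forall>x\<in>P. \<forall>x'\<in>gedges C. x \<inter> x' \<noteq> {} \<longrightarrow> x' \<in> P" for P
    proof -
      obtain i0 where i0: "i0 < n" "e i0 \<in> P" using P(1,2) unfolding E by blast
      have step: "e (Suc i mod n) \<in> P" if "i < n" "e i \<in> P" for i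
      proof -
        have "Suc i mod n < n" using n3 by simp
        then have "e (Suc i mod n) \<in> gedges C" unfolding E by blast
        moreover have "vs ! (Suc i mod n) \<in> e i \<inter> e (Suc i mod n)" unfolding e_def by blast
        ultimately show ?thesis using P(3) that by blast
      qed
      have all: "e ((i0 + d) mod n) \<in> P" for d
      proof (induction d)
        case 0 then show ?case using i0 by simp
      next
        case (Suc d)
        have "(i0 + d) mod n < n" using n3 by simp
        from step[OF this Suc] show ?case by (simp add: mod_Suc_eq)
      qed
      have "e i \<in> P" if "i < n" for i
      proof -
        \<comment> \<open>The number of steps from \<open>i0\<close> to \<open>i\<close>, with a
          full turn added so that the subtraction stays in the naturals.\<close>
        have "(i0 + (n - i0 + i)) mod n = i" using i0 that by simp
        then show ?thesis using all by metis
      qed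
      then show ?thesis using P(1) unfolding E by blast
    qed
    show "\<exists>A\<subseteq>gedges C. \<forall>v\<in>\<Union>(gedges C). \<exists>!x. x \<in> A \<and> v \<in> x"
    proof (intro exI[of _ "e ` {i. i < n \<and> even i}"] conjI ballI)
      show "e ` {i. i < n \<and> even i} \<subseteq> gedges C" unfolding E by blast
      fix v assume v: "v \<in> \<Union>(gedges C)"
      obtain j k where jk: "j < n" "k < n" "even j \<longleftrightarrow> odd k" "\<forall>i<n. v \<in> e i \<longleftrightarrow> i = j \<or> i = k"
        using at[OF v[unfolded vsE]] by meson
      show "\<exists>!x. x \<in> e ` {i. i < n \<and> even i} \<and> v \<in> x"
      proof (cases "even j")
        case True
        show ?thesis by (rule ex1I[of _ "e j"]) (use True jk in auto)
      next
        case False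
        show ?thesis by (rule ex1I[of _ "e k"]) (use False jk in auto)
      qed
    qed
  qed
qed

section \<open>Perfect matchings and hypercubes\<close>

lemma perfect_matching_edge:
  assumes "perfect_matching G M" "v \<in> gverts G"
  obtains e where "e \<in> M" "v \<in> e" "\<And>e'. e' \<in> M \<Longrightarrow> v \<in> e' \<Longrightarrow> e' = e"
  using assms unfolding perfect_matching_def by metis

lemma perfect_matching_unique:
  assumes "perfect_matching G M" "v \<in> gverts G" "e \<in> M" "v \<in> e" "e' \<in> M" "v \<in> e'"
  shows "e = e'"
  using assms unfolding perfect_matching_def by metis

text \<open>Bit strings are exchanged for subsets of any set \<open>D\<close> of \<open>n\<close>
  directions, so that a cube of matchings can be indexed by sets of switched circuits, and an
  unknown cube by sets of coordinates. The bijection runs from the subsets to \<open>K\<close>,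
  against the direction of \<open>graph_isomorphic\<close>, because later it is given by a formula
  in the subset.\<close>

lemma hypercube_iso_subsets:
  assumes D: "finite D" "card D = n"
  shows "graph_isomorphic K (hypercube n) \<longleftrightarrow>
    (\<exists>\<phi>. bij_betw \<phi> (Pow D) (gverts K) \<and>
      (\<forall>A\<in>Pow D. \<forall>B\<in>Pow D. {\<phi> A, \<phi> B} \<in> gedges K \<longleftrightarrow> card (sym_diff A B) = 1))"
proof -
  obtain d where d: "bij_betw d {..<n} D"
    using ex_bij_betw_nat_finite[OF D(1)] D(2) by (auto simp: atLeast0LessThan)
  define s where "s xs = d ` {i. i < n \<and> xs ! i}" for xs
  have dinj: "inj_on d {..<n}" and dD: "d ` {..<n} = D" using d by (auto simp: bij_betw_def)
  have bs: "bij_betw s {xs. length xs = n} (Pow D)" unfolding bij_betw_def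
  proof
    show "inj_on s {xs. length xs = n}"
    proof (rule inj_onI)
      fix xs ys assume l: "xs \<in> {xs. length xs = n}" "ys \<in> {xs. length xs = n}" and "s xs = s ys"
      then have "{i. i < n \<and> xs ! i} = {i. i < n \<and> ys ! i}"
        unfolding s_def by (subst (asm) inj_on_image_eq_iff[OF dinj]) auto
      then show "xs = ys" using l by (intro nth_equalityI) auto
    qed
    show "s ` {xs. length xs = n} = Pow D"
    proof
      show "s ` {xs. length xs = n} \<subseteq> Pow D" using dD unfolding s_def by blast
      show "Pow D \<subseteq> s ` {xs. length xs = n}"
      proof
        fix A assume "A \<in> Pow D"
        then have "A = s (map (\<lambda>i. d i \<in> A) [0..<n])" using dD unfolding s_def by auto
        then show "A \<in> s ` {xs. length xs = n}" by (auto intro: image_eqI)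
      qed
    qed
  qed
  have sd: "card (sym_diff (s xs) (s ys)) = card {i. i < n \<and> xs ! i \<noteq> ys ! i}" for xs ys
  proof -
    have "sym_diff (s xs) (s ys) = d ` {i. i < n \<and> xs ! i \<noteq> ys ! i}"
      unfolding s_def using dinj by (auto simp: inj_on_def)
    then show ?thesis
      by (simp add: card_image inj_on_subset[OF dinj] subset_iff)
  qed
  have he: "{xs, ys} \<in> gedges (hypercube n) \<longleftrightarrow> card (sym_diff (s xs) (s ys)) = 1"
    if "length xs = n" "length ys = n" for xs ys
  proof -
    have "card {i. i < n \<and> ys ! i \<noteq> xs ! i} = card {i. i < n \<and> xs ! i \<noteq> ys ! i}"
      by (rule arg_cong[of _ _ card]) auto
    then show ?thesis unfolding sd hypercube_def using that by (auto simp: doubleton_eq_iff)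
  qed
  have hv: "gverts (hypercube n) = {xs. length xs = n}" unfolding hypercube_def by simp
  show ?thesis
  proof
    assume "graph_isomorphic K (hypercube n)"
    then obtain h where h: "bij_betw h (gverts K) {xs. length xs = n}"
      and he': "\<And>u v. u \<in> gverts K \<Longrightarrow> v \<in> gverts K \<Longrightarrow> {u, v} \<in> gedges K \<longleftrightarrow> {h u, h v} \<in> gedges (hypercube n)"
      unfolding graph_isomorphic_def hv by blast
    have b: "bij_betw (s \<circ> h) (gverts K) (Pow D)" using bij_betw_trans[OF h bs] .
    define \<phi> where "\<phi> = inv_into (gverts K) (s \<circ> h)"
    have \<phi>: "bij_betw \<phi> (Pow D) (gverts K)" unfolding \<phi>_def by (rule bij_betw_inv_into[OF b])
    have r: "s (h (\<phi> A)) = A" "\<phi> A \<in> gverts K" if "A \<in> Pow D" for A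
      using bij_betw_inv_into_right[OF b that] bij_betwE[OF \<phi>] that unfolding \<phi>_def by auto
    have "{\<phi> A, \<phi> B} \<in> gedges K \<longleftrightarrow> card (sym_diff A B) = 1" if "A \<in> Pow D" "B \<in> Pow D" for A B
    proof -
      have "length (h (\<phi> A)) = n" "length (h (\<phi> B)) = n" using bij_betwE[OF h] r that by auto
      then show ?thesis using he he' r that by metis
    qed
    then show "\<exists>\<phi>. bij_betw \<phi> (Pow D) (gverts K) \<and>
      (\<forall>A\<in>Pow D. \<forall>B\<in>Pow D. {\<phi> A, \<phi> B} \<in> gedges K \<longleftrightarrow> card (sym_diff A B) = 1)" using \<phi> by blast
  next
    assume "\<exists>\<phi>. bij_betw \<phi> (Pow D) (gverts K) \<and>
      (\<forall>A\<in>Pow D. \<forall>B\<in>Pow D. {\<phi> A, \<phi> B} \<in> gedges K \<longleftrightarrow> card (sym_diff A B) = 1)"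
    then obtain \<phi> where \<phi>: "bij_betw \<phi> (Pow D) (gverts K)"
      and adj: "\<And>A B. A \<in> Pow D \<Longrightarrow> B \<in> Pow D \<Longrightarrow> {\<phi> A, \<phi> B} \<in> gedges K \<longleftrightarrow> card (sym_diff A B) = 1"
      by blast
    have b: "bij_betw (\<phi> \<circ> s) {xs. length xs = n} (gverts K)" using bij_betw_trans[OF bs \<phi>] .
    define h where "h = inv_into {xs. length xs = n} (\<phi> \<circ> s)"
    have h: "bij_betw h (gverts K) {xs. length xs = n}" unfolding h_def by (rule bij_betw_inv_into[OF b])
    have r: "\<phi> (s (h u)) = u" "length (h u) = n" "s (h u) \<in> Pow D" if "u \<in> gverts K" for u
      using bij_betw_inv_into_right[OF b that] bij_betwE[OF h] that bij_betwE[OF bs] unfolding h_def by auto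
    have "{u, v} \<in> gedges K \<longleftrightarrow> {h u, h v} \<in> gedges (hypercube n)" if "u \<in> gverts K" "v \<in> gverts K" for u v
      using he[of "h u" "h v"] adj[of "s (h u)" "s (h v)"] r that by metis
    then show "graph_isomorphic K (hypercube n)" unfolding graph_isomorphic_def hv using h by blast
  qed
qed

section \<open>Clar covers as cubes of perfect matchings\<close>

text \<open>The combinatorial setting: \<C> is to be the set of boundaries of the faces in
  \<open>F\<close>, as edge sets. The assumption \<open>no_four\<close> is what the properness of
  \<open>F\<close> will provide.\<close>

locale resonant_graph =
  fixes G :: "'v ugraph" and \<C> :: "'v set set set"
  assumes simple: "finite_simple_graph G"
    and circuit: "C \<in> \<C> \<Longrightarrow> circuit C"
    and circuit_edges: "C \<in> \<C> \<Longrightarrow> C \<subseteq> gedges G"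
    and no_four: "\<lbrakk>C1 \<in> \<C>; C2 \<in> \<C>; C3 \<in> \<C>; C4 \<in> \<C>; distinct [C1, C2, C3, C4];
      sym_diff C1 C2 = sym_diff C3 C4\<rbrakk> \<Longrightarrow> False"
begin

definition resonance :: "'v set set ugraph" where
  "resonance = (Collect (perfect_matching G),
     {{M1, M2} | M1 M2. perfect_matching G M1 \<and> perfect_matching G M2 \<and> sym_diff M1 M2 \<in> \<C>})"

text \<open>The members of \<D> are pairwise vertex-disjoint \<open>M\<close>-alternating circuits.
  Alternation is expressed by the condition that the matching edge at every vertex of a circuit
  stays on that circuit.\<close>

definition resonant :: "'v set set \<Rightarrow> 'v set set set \<Rightarrow> bool" where
  "resonant M \<D> \<longleftrightarrow> perfect_matching G M \<and> \<D> \<subseteq> \<C> \<and>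
     (\<forall>C\<in>\<D>. \<forall>e\<in>M. e \<inter> \<Union>C \<noteq> {} \<longrightarrow> e \<in> C) \<and>
     (\<forall>C\<in>\<D>. \<forall>C'\<in>\<D>. C \<noteq> C' \<longrightarrow> \<Union>C \<inter> \<Union>C' = {})"

definition cover :: "'v set set \<Rightarrow> 'v set set set \<Rightarrow> 'v ugraph" where
  "cover M \<D> = (gverts G, M \<union> \<Union>\<D>)"

definition matchings_in :: "'v ugraph \<Rightarrow> 'v set set set" where
  "matchings_in S = {M. perfect_matching G M \<and> M \<subseteq> gedges S}"

definition cyc :: "'v ugraph set" where "cyc = (\<lambda>C. (\<Union>C, C)) ` \<C>"

lemma edge_verts: "e \<in> gedges G \<Longrightarrow> e \<subseteq> gverts G" "e \<in> gedges G \<Longrightarrow> card e = 2"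
  using simple unfolding finite_simple_graph_def by auto

lemma finite_gedges: "finite (gedges G)"
proof (rule finite_subset)
  show "gedges G \<subseteq> Pow (gverts G)" using edge_verts by blast
  show "finite (Pow (gverts G))" using simple unfolding finite_simple_graph_def by simp
qed

lemma finite_circuits: "finite \<C>"
  by (rule finite_subset[of _ "Pow (gedges G)"]) (use circuit_edges finite_gedges in auto)

lemma circuit_verts: "C \<in> \<C> \<Longrightarrow> v \<in> \<Union>C \<Longrightarrow> v \<in> gverts G"
  using circuit_edges edge_verts by blast

lemma matching_edges: "perfect_matching G M \<Longrightarrow> M \<subseteq> gedges G"
  unfolding perfect_matching_def by blast

lemma resonance_edge:
  assumes "perfect_matching G M" "perfect_matching G M'"
  shows "{M, M'} \<in> gedges resonance \<longleftrightarrow> sym_diff M M' \<in> \<C>"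
proof
  have c: "sym_diff M M' = sym_diff M' M" by blast
  assume "{M, M'} \<in> gedges resonance"
  then obtain N N' where "{M, M'} = {N, N'}" "sym_diff N N' \<in> \<C>" unfolding resonance_def by auto
  then show "sym_diff M M' \<in> \<C>" using c by (metis doubleton_eq_iff)
next
  assume "sym_diff M M' \<in> \<C>"
  then show "{M, M'} \<in> gedges resonance" using assms unfolding resonance_def snd_conv by blast
qed

text \<open>Some edge at \<open>v\<close> belongs to exactly one of the two matchings. The edge of
  the other matching at \<open>v\<close> is then a different one, so neither is common to both
  matchings and both lie in the difference.\<close>

lemma alternating:
  assumes "perfect_matching G M" "perfect_matching G M'" "sym_diff M M' \<in> \<C>"
    and v: "v \<in> \<Union>(sym_diff M M')" and e: "e \<in> M \<union> M'" "v \<in> e"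
  shows "e \<in> sym_diff M M'"
proof -
  have vG: "v \<in> gverts G" using circuit_verts assms(3) v by blast
  obtain x where x: "x \<in> sym_diff M M'" "v \<in> x" using v by blast
  show ?thesis
    using perfect_matching_unique[OF assms(1) vG] perfect_matching_unique[OF assms(2) vG]
      perfect_matching_edge[OF assms(1) vG] perfect_matching_edge[OF assms(2) vG] x e by blast
qed

text \<open>The four sides sum to zero modulo 2, which with \<open>no_four\<close> forces opposite
  sides to agree. For disjointness, let \<open>g\<close> and \<open>h\<close> be the circuits of the
  two directions. At a common vertex, the edges of \<open>M1\<close> and \<open>M4\<close> lie on
  both circuits, so \<open>g\<close> and \<open>h\<close> have the same two edges there.
  Connectedness spreads this agreement along both circuits, giving \<open>g = h\<close>, although
  consecutive sides differ.\<close>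

lemma square:
  assumes M: "perfect_matching G M1" "perfect_matching G M2" "perfect_matching G M3" "perfect_matching G M4"
    and C: "sym_diff M1 M2 \<in> \<C>" "sym_diff M2 M3 \<in> \<C>" "sym_diff M3 M4 \<in> \<C>" "sym_diff M4 M1 \<in> \<C>"
    and ne: "M1 \<noteq> M3" "M2 \<noteq> M4"
  shows "sym_diff M3 M4 = sym_diff M1 M2" "\<Union>(sym_diff M1 M2) \<inter> \<Union>(sym_diff M4 M1) = {}"
proof -
  have eq: "sym_diff (sym_diff M1 M2) (sym_diff M2 M3) = sym_diff (sym_diff M3 M4) (sym_diff M4 M1)" by blast
  have d: "sym_diff M1 M2 \<noteq> sym_diff M2 M3" "sym_diff M2 M3 \<noteq> sym_diff M3 M4"
    "sym_diff M3 M4 \<noteq> sym_diff M4 M1" "sym_diff M4 M1 \<noteq> sym_diff M1 M2" using ne by blast+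
  show g: "sym_diff M3 M4 = sym_diff M1 M2"
  proof (rule ccontr)
    assume n: "sym_diff M3 M4 \<noteq> sym_diff M1 M2"
    \<comment> \<open>As the sides sum to zero, one pair of opposite sides agrees exactly when the
      other does.\<close>
    then have "sym_diff M2 M3 \<noteq> sym_diff M4 M1" by blast
    then show False using no_four[OF C _ eq] d n by auto
  qed
  define g where "g = sym_diff M1 M2"
  define h where "h = sym_diff M4 M1"
  have gC: "g \<in> \<C>" and hC: "h \<in> \<C>" using C g_def h_def by auto
  have shared: "{e\<in>g. v \<in> e} = {e\<in>h. v \<in> e}" if v: "v \<in> \<Union>g" "v \<in> \<Union>h" for v
  proof -
    have vG: "v \<in> gverts G" using circuit_verts gC v by blast
    obtain a where a: "a \<in> M1" "v \<in> a" using perfect_matching_edge[OF M(1) vG] by blast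
    obtain b where b: "b \<in> M4" "v \<in> b" using perfect_matching_edge[OF M(4) vG] by blast
    have ag: "a \<in> g" using alternating[OF M(1,2) C(1)] v a unfolding g_def by blast
    have ah: "a \<in> h" using alternating[OF M(4,1) C(4)] v a unfolding h_def by blast
    \<comment> \<open>Here the first claim is used: \<open>g\<close> is also the difference of
      \<open>M3\<close> and \<open>M4\<close>, hence alternating for \<open>M4\<close>.\<close>
    have bg: "b \<in> g" using alternating[OF M(3,4) C(3)] v b unfolding g g_def by blast
    have bh: "b \<in> h" using alternating[OF M(4,1) C(4)] v b unfolding h_def by blast
    have ab: "a \<noteq> b" using a b ah unfolding h_def by blast
    have two: "{e\<in>x. v \<in> e} = {a, b}" if x: "x \<in> \<C>" "v \<in> \<Union>x" "a \<in> x" "b \<in> x" for x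
    proof -
      have c: "card {e\<in>x. v \<in> e} = 2" by (rule circuit_degree[OF circuit[OF x(1)] x(2)])
      have "{a, b} \<subseteq> {e\<in>x. v \<in> e}" using x a b by blast
      moreover have "finite {e\<in>x. v \<in> e}" using c by (simp add: card_ge_0_finite)
      moreover have "card {a, b} = 2" using ab by simp
      ultimately show ?thesis using c by (metis card_subset_eq)
    qed
    show ?thesis using two[OF gC v(1) ag bg] two[OF hC v(2) ah bh] by simp
  qed
  show "\<Union>(sym_diff M1 M2) \<inter> \<Union>(sym_diff M4 M1) = {}"
  proof (rule ccontr)
    assume "\<Union>(sym_diff M1 M2) \<inter> \<Union>(sym_diff M4 M1) \<noteq> {}"
    then obtain v where v: "v \<in> \<Union>g" "v \<in> \<Union>h" unfolding g_def h_def by blast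
    then obtain e where "e \<in> g" "v \<in> e" by blast
    then have ne': "g \<inter> h \<noteq> {}" using shared v by blast
    \<comment> \<open>An edge common to both circuits passes its membership in the intersection on
      to every edge touching it, since by \<open>shared\<close> the circuits coincide at its
      ends.\<close>
    have "g \<inter> h = g" by (rule circuit_connected[OF circuit[OF gC]]) (use ne' shared in blast)+
    moreover have "g \<inter> h = h" by (rule circuit_connected[OF circuit[OF hC]]) (use ne' shared in blast)+
    ultimately show False using d unfolding g_def h_def by blast
  qed
qed

lemma resonantD:
  assumes "resonant M \<D>"
  shows "perfect_matching G M" "\<D> \<subseteq> \<C>"
    "\<And>C e v. C \<in> \<D> \<Longrightarrow> e \<in> M \<Longrightarrow> v \<in> e \<Longrightarrow> v \<in> \<Union>C \<Longrightarrow> e \<in> C"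
    "\<And>C C' v. C \<in> \<D> \<Longrightarrow> C' \<in> \<D> \<Longrightarrow> v \<in> \<Union>C \<Longrightarrow> v \<in> \<Union>C' \<Longrightarrow> C = C'"
proof -
  have r: "\<forall>C\<in>\<D>. \<forall>e\<in>M. e \<inter> \<Union>C \<noteq> {} \<longrightarrow> e \<in> C"
    "\<forall>C\<in>\<D>. \<forall>C'\<in>\<D>. C \<noteq> C' \<longrightarrow> \<Union>C \<inter> \<Union>C' = {}"
    and "perfect_matching G M" "\<D> \<subseteq> \<C>" using assms unfolding resonant_def by simp_all
  then show "perfect_matching G M" "\<D> \<subseteq> \<C>" by simp_all
  show "e \<in> C" if "C \<in> \<D>" "e \<in> M" "v \<in> e" "v \<in> \<Union>C" for C e v using r(1) that by blast
  show "C = C'" if "C \<in> \<D>" "C' \<in> \<D>" "v \<in> \<Union>C" "v \<in> \<Union>C'" for C C' v using r(2) that by blast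
qed

text \<open>At a vertex of a switched circuit the matching edge is one of the two circuit edges, and
  switching exchanges it for the other. No second circuit of \<D> interferes, by disjointness;
  vertices off the switched circuits keep their edge.\<close>

lemma perfect_matching_flip:
  assumes r: "resonant M \<D>" and J: "J \<subseteq> \<D>"
  shows "perfect_matching G (sym_diff M (\<Union>J))"
  unfolding perfect_matching_def
proof (intro conjI ballI)
  note rd = resonantD[OF r]
  have JC: "J \<subseteq> \<C>" using J rd(2) by blast
  show "sym_diff M (\<Union>J) \<subseteq> gedges G" using matching_edges[OF rd(1)] JC circuit_edges by blast
  fix v assume v: "v \<in> gverts G"
  obtain e where e: "e \<in> M" "v \<in> e" and eu: "\<And>x. x \<in> M \<Longrightarrow> v \<in> x \<Longrightarrow> x = e"
    using perfect_matching_edge[OF rd(1) v] by metis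
  show "\<exists>!x. x \<in> sym_diff M (\<Union>J) \<and> v \<in> x"
  proof (cases "\<exists>C\<in>J. v \<in> \<Union>C")
    case False
    then have nJ: "x \<notin> \<Union>J" if "v \<in> x" for x using that by blast
    show ?thesis
    proof (rule ex1I[of _ e])
      show "e \<in> sym_diff M (\<Union>J) \<and> v \<in> e" using nJ[OF e(2)] e by simp
      fix x assume x: "x \<in> sym_diff M (\<Union>J) \<and> v \<in> x"
      then have "x \<in> M" using nJ[of x] by simp
      then show "x = e" using eu x by simp
    qed
  next
    case True
    then obtain C where C: "C \<in> J" "v \<in> \<Union>C" by blast
    have eC: "e \<in> C" using rd(3) C J e by blast
    obtain e' where e': "e' \<noteq> e" "{x\<in>C. v \<in> x} = {e, e'}"
      using circuit_other_edge[OF circuit _ e(2)] eC C JC by blast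
    have "e' \<in> C" "v \<in> e'" using e'(2) by blast+
    moreover have "e' \<notin> M" using eu calculation e' by blast
    moreover have "x = e'" if x: "x \<in> sym_diff M (\<Union>J)" "v \<in> x" for x
    proof (cases "x \<in> M")
      case True then show ?thesis using eu x eC C by blast
    next
      case False
      then obtain C' where C': "C' \<in> J" "x \<in> C'" using x by blast
      then have "C' = C" using rd(4)[of C' C v] C J x by blast
      then have "x \<in> {x\<in>C. v \<in> x}" using C' x by simp
      then have "x \<in> {e, e'}" unfolding e'(2) .
      then show ?thesis using False e by auto
    qed
    ultimately show ?thesis using C by blast
  qed
qed

text \<open>On each circuit a matching \<open>M'\<close> inside the cover either equals
  \<open>M\<close> or is complementary to it: at a vertex both matchings use one of the same two
  edges, so agreement at one of these edges implies agreement at the other, and the edges of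
  agreement are closed under touching. The set \<open>J\<close> collects the circuits of the second
  kind.\<close>

lemma matchings_in_cover:
  assumes r: "resonant M \<D>"
  shows "matchings_in (cover M \<D>) = (\<lambda>J. sym_diff M (\<Union>J)) ` Pow \<D>"
proof
  note rd = resonantD[OF r]
  show "(\<lambda>J. sym_diff M (\<Union>J)) ` Pow \<D> \<subseteq> matchings_in (cover M \<D>)"
    using perfect_matching_flip[OF r] unfolding matchings_in_def cover_def by auto
  show "matchings_in (cover M \<D>) \<subseteq> (\<lambda>J. sym_diff M (\<Union>J)) ` Pow \<D>"
  proof
    fix M' assume "M' \<in> matchings_in (cover M \<D>)"
    then have M': "perfect_matching G M'" "M' \<subseteq> M \<union> \<Union>\<D>" unfolding matchings_in_def cover_def by auto
    have in_C: "e \<in> C" if "C \<in> \<D>" "e \<in> M \<union> M'" "v \<in> e" "v \<in> \<Union>C" for C e v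
      using that M'(2) rd(3,4) by blast
    have dich: "(\<forall>e\<in>C. e \<in> M \<longleftrightarrow> e \<in> M') \<or> (\<forall>e\<in>C. e \<in> M \<longleftrightarrow> e \<notin> M')" if C: "C \<in> \<D>" for C
    proof (cases "{e\<in>C. e \<in> M \<longleftrightarrow> e \<in> M'} = {}")
      case False
      have "{e\<in>C. e \<in> M \<longleftrightarrow> e \<in> M'} = C"
      proof (rule circuit_connected[OF circuit _ False])
        show "C \<in> \<C>" using C rd(2) by blast
        fix e e' assume e: "e \<in> {e\<in>C. e \<in> M \<longleftrightarrow> e \<in> M'}" and e': "e' \<in> C" "e \<inter> e' \<noteq> {}"
        obtain v where v: "v \<in> e" "v \<in> e'" using e' by blast
        have eC: "e \<in> C" using e by blast
        then obtain e'' where e'': "e'' \<noteq> e" "{x\<in>C. v \<in> x} = {e, e''}"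
          using circuit_other_edge[OF circuit[OF \<open>C \<in> \<C>\<close>] eC v(1)] by blast
        have vG: "v \<in> gverts G" using circuit_verts \<open>C \<in> \<C>\<close> e' v by blast
        obtain a where a: "a \<in> M" "v \<in> a" "\<And>x. x \<in> M \<Longrightarrow> v \<in> x \<Longrightarrow> x = a"
          using perfect_matching_edge[OF rd(1) vG] by metis
        obtain b where b: "b \<in> M'" "v \<in> b" "\<And>x. x \<in> M' \<Longrightarrow> v \<in> x \<Longrightarrow> x = b"
          using perfect_matching_edge[OF M'(1) vG] by metis
        have "a \<in> {x\<in>C. v \<in> x}" "b \<in> {x\<in>C. v \<in> x}" using in_C[OF C] a b v eC by blast+
        then have ab: "a \<in> {e, e''}" "b \<in> {e, e''}" unfolding e''(2) .
        have "e' \<in> {e, e''}" using e''(2) e' v by blast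
        then have "e' \<in> M \<longleftrightarrow> e' \<in> M'" using ab a b e v e'' by blast
        then show "e' \<in> {e\<in>C. e \<in> M \<longleftrightarrow> e \<in> M'}" using e' by blast
      qed blast
      then show ?thesis by blast
    qed blast
    define J where "J = {C\<in>\<D>. \<forall>e\<in>C. e \<in> M \<longleftrightarrow> e \<notin> M'}"
    \<comment> \<open>Off the circuits \<open>M'\<close> can only use edges of \<open>M\<close>.
      Conversely, the \<open>M'\<close>-edge at an end of such an \<open>e\<close> is in
      \<open>M\<close>, since lying on a circuit would by alternation put \<open>e\<close> on it as
      well.\<close>
    have other: "e \<in> M \<longleftrightarrow> e \<in> M'" if e: "\<forall>C\<in>\<D>. e \<notin> C" for e
    proof
      assume "e \<in> M'" then show "e \<in> M" using M'(2) e by blast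
    next
      assume eM: "e \<in> M"
      then have eG: "e \<in> gedges G" using matching_edges[OF rd(1)] by blast
      then obtain v where v: "v \<in> e" using edge_verts(2) by fastforce
      then have vG: "v \<in> gverts G" using eG edge_verts by blast
      obtain b where b: "b \<in> M'" "v \<in> b" using perfect_matching_edge[OF M'(1) vG] by blast
      have "b \<in> M" using M'(2) b v rd(3) eM e by blast
      then show "e \<in> M'" using perfect_matching_unique[OF rd(1) vG] b eM v by blast
    qed
    have "M' = sym_diff M (\<Union>J)"
    proof (rule set_eqI)
      fix e
      show "e \<in> M' \<longleftrightarrow> e \<in> sym_diff M (\<Union>J)"
      proof (cases "\<exists>C\<in>\<D>. e \<in> C")
        case False then show ?thesis using other unfolding J_def by blast
      next
        case True
        then obtain C where C: "C \<in> \<D>" "e \<in> C" by blast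
        then have "e \<in> gedges G" using circuit_edges rd(2) by blast
        then obtain v where v: "v \<in> e" using edge_verts(2) by fastforce
        have "e \<in> \<Union>J \<longleftrightarrow> C \<in> J" using rd(4)[OF C(1), of _ v] C v unfolding J_def by blast
        then show ?thesis using dich[OF C(1)] C unfolding J_def by blast
      qed
    qed
    then show "M' \<in> (\<lambda>J. sym_diff M (\<Union>J)) ` Pow \<D>" unfolding J_def by blast
  qed
qed

text \<open>Two matchings suffice: \<open>M\<close> itself and \<open>M\<close> with every circuit
  switched. This is what later makes the passage from covers to cubes injective.\<close>

lemma Union_matchings_in_cover:
  assumes r: "resonant M \<D>"
  shows "\<Union>(matchings_in (cover M \<D>)) = gedges (cover M \<D>)"
proof
  show "\<Union>(matchings_in (cover M \<D>)) \<subseteq> gedges (cover M \<D>)" unfolding matchings_in_def by blast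
  have "sym_diff M (\<Union>{}) \<in> matchings_in (cover M \<D>)" "sym_diff M (\<Union>\<D>) \<in> matchings_in (cover M \<D>)"
    unfolding matchings_in_cover[OF r] by blast+
  moreover have "gedges (cover M \<D>) \<subseteq> sym_diff M (\<Union>{}) \<union> sym_diff M (\<Union>\<D>)" unfolding cover_def by auto
  ultimately show "gedges (cover M \<D>) \<subseteq> \<Union>(matchings_in (cover M \<D>))" by blast
qed

end

section \<open>Components of a cover, and Clar covers as covers\<close>

lemma reachable_refl: "reachable_in S u u"
  unfolding reachable_in_def by simp

lemma reachable_sym: "reachable_in S u v \<Longrightarrow> reachable_in S v u"
proof -
  have "sym {(x, y). {x, y} \<in> gedges S}" by (auto simp: sym_def insert_commute)
  then have "sym ({(x, y). {x, y} \<in> gedges S}\<^sup>*)" by (rule sym_rtrancl)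
  then show "reachable_in S u v \<Longrightarrow> reachable_in S v u" unfolding reachable_in_def by (rule symD)
qed

lemma reachable_trans: "reachable_in S u v \<Longrightarrow> reachable_in S v w \<Longrightarrow> reachable_in S u w"
  unfolding reachable_in_def by (rule rtrancl_trans)

lemma reachable_edge: "{u, v} \<in> gedges S \<Longrightarrow> reachable_in S u v"
  unfolding reachable_in_def by auto

lemma reachable_closed:
  assumes "reachable_in S u v" "u \<in> A" "\<And>x. x \<in> gedges S \<Longrightarrow> x \<inter> A \<noteq> {} \<Longrightarrow> x \<subseteq> A"
  shows "v \<in> A"
  using assms(1,2) unfolding reachable_in_def
proof (induction rule: rtrancl_induct)
  case (step y z)
  then have "{y, z} \<subseteq> A" by (intro assms(3)) auto
  then show ?case by simp
qed

lemma edge_reachable: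
  assumes "x \<in> gedges S" "card x = 2" "a \<in> x" "b \<in> x"
  shows "reachable_in S a b"
proof -
  obtain c d where x: "x = {c, d}" using assms(2) by (meson card_2_iff)
  show ?thesis
  proof (cases "a = b")
    case True then show ?thesis by (simp only: reachable_refl)
  next
    case False
    then have "x = {a, b}" using x assms(3,4) by auto
    then show ?thesis using reachable_edge assms(1) by metis
  qed
qed

text \<open>Translates connectedness of the edge set into connectedness of the vertices: the edges
  with all ends reachable from \<open>u\<close> are closed under touching.\<close>

lemma circuit_reachable:
  assumes "circuit C" "C \<subseteq> gedges S" "\<And>e. e \<in> C \<Longrightarrow> card e = 2" "u \<in> \<Union>C" "v \<in> \<Union>C"
  shows "reachable_in S u v"
proof -
  let ?P = "{e\<in>C. \<forall>w\<in>e. reachable_in S u w}"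
  obtain x where x: "x \<in> C" "u \<in> x" using assms(4) by blast
  have "x \<in> ?P" using edge_reachable[of x S u] x assms by blast
  then have ne: "?P \<noteq> {}" by blast
  have "?P = C"
  proof (rule circuit_connected[OF assms(1) _ ne])
    fix e e' assume e: "e \<in> ?P" and e': "e' \<in> C" "e \<inter> e' \<noteq> {}"
    obtain a where a: "a \<in> e" "a \<in> e'" using e' by blast
    have "reachable_in S u w" if "w \<in> e'" for w
    proof (rule reachable_trans)
      show "reachable_in S u a" using e a by blast
      show "reachable_in S a w" using edge_reachable[of e' S a w] e' a that assms by blast
    qed
    then show "e' \<in> ?P" using e' by blast
  qed blast
  then show ?thesis using assms(5) by blast
qed

context resonant_graph
begin

abbreviation component :: "'v ugraph \<Rightarrow> 'v \<Rightarrow> 'v ugraph" where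
  "component S u \<equiv> induced_subgraph_on S {v \<in> gverts S. reachable_in S u v}"

lemma circuit_nonempty: "C \<in> \<C> \<Longrightarrow> \<exists>v. v \<in> \<Union>C"
proof -
  assume C: "C \<in> \<C>"
  have "C \<noteq> {}" using circuit[OF C] unfolding circuit_def by (rule conjunct1)
  then obtain e where e: "e \<in> C" by blast
  then have "card e = 2" using circuit_edges[OF C] edge_verts by blast
  then have "e \<noteq> {}" by auto
  then show ?thesis using e by blast
qed

lemma singleton_not_circuit: "{e} \<notin> \<C>"
proof
  assume C: "{e} \<in> \<C>"
  then obtain v where "v \<in> e" using circuit_nonempty[OF C] by auto
  from not_circuit_singleton[OF this] circuit[OF C] show False by (rule notE)
qed

lemma edge_in_unique_circuit:
  assumes r: "resonant M \<D>" and "C \<in> \<D>" "C' \<in> \<D>" "e \<in> C" "e \<in> C'"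
  shows "C = C'"
proof -
  note rd = resonantD[OF r]
  have "card e = 2" using assms rd(2) circuit_edges edge_verts by blast
  then obtain v where "v \<in> e" by fastforce
  then show ?thesis using rd(4)[of C C' v] assms by blast
qed

text \<open>No edge of the cover leaves a circuit of \<D>: a matching edge touching it lies on it by
  alternation, and an edge of another circuit does not touch it.\<close>

lemma component_circuit:
  assumes r: "resonant M \<D>" and C: "C \<in> \<D>" and v: "v \<in> \<Union>C"
  shows "component (cover M \<D>) v = (\<Union>C, C)"
proof -
  note rd = resonantD[OF r]
  let ?S = "cover M \<D>"
  have CC: "C \<in> \<C>" using C rd(2) by blast
  have touch: "x \<in> C" if x: "x \<in> gedges ?S" "a \<in> x" "a \<in> \<Union>C" for x a
  proof (cases "x \<in> M")
    case True then show ?thesis using rd(3)[OF C] x by blast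
  next
    case False
    then obtain C' where "C' \<in> \<D>" "x \<in> C'" using x(1) unfolding cover_def by auto
    then show ?thesis using rd(4)[OF C, of C' a] x by blast
  qed
  have CS: "C \<subseteq> gedges ?S" using C unfolding cover_def by auto
  have "{w \<in> gverts ?S. reachable_in ?S v w} = \<Union>C"
  proof
    show "{w \<in> gverts ?S. reachable_in ?S v w} \<subseteq> \<Union>C"
    proof
      fix w assume "w \<in> {w \<in> gverts ?S. reachable_in ?S v w}"
      then have "reachable_in ?S v w" by blast
      then show "w \<in> \<Union>C" by (rule reachable_closed) (use v touch in blast)+
    qed
    show "\<Union>C \<subseteq> {w \<in> gverts ?S. reachable_in ?S v w}"
    proof
      fix w assume w: "w \<in> \<Union>C"
      have "reachable_in ?S v w"
        by (rule circuit_reachable[OF circuit[OF CC] CS _ v w]) (use CC circuit_edges edge_verts in blast)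
      then show "w \<in> {w \<in> gverts ?S. reachable_in ?S v w}"
        using circuit_verts[OF CC w] unfolding cover_def by simp
    qed
  qed
  \<comment> \<open>Components are induced subgraphs, so chords of \<open>C\<close> in the cover
    have to be excluded too; any such edge touches \<open>C\<close>.\<close>
  moreover have "{e \<in> gedges ?S. e \<subseteq> \<Union>C} = C"
  proof
    show "C \<subseteq> {e \<in> gedges ?S. e \<subseteq> \<Union>C}" using CS by blast
    show "{e \<in> gedges ?S. e \<subseteq> \<Union>C} \<subseteq> C"
    proof
      fix x assume x: "x \<in> {e \<in> gedges ?S. e \<subseteq> \<Union>C}"
      then have "x \<in> gedges G" using matching_edges[OF rd(1)] rd(2) circuit_edges unfolding cover_def by auto
      then obtain a where "a \<in> x" using edge_verts(2) by fastforce
      then show "x \<in> C" using touch x by blast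
    qed
  qed
  ultimately show ?thesis unfolding induced_subgraph_on_def by simp
qed

lemma component_edge:
  assumes r: "resonant M \<D>" and e: "e \<in> M" "v \<in> e" and out: "\<And>C. C \<in> \<D> \<Longrightarrow> v \<notin> \<Union>C"
  shows "component (cover M \<D>) v = (e, {e})"
proof -
  note rd = resonantD[OF r]
  let ?S = "cover M \<D>"
  have eG: "e \<in> gedges G" using e matching_edges[OF rd(1)] by blast
  \<comment> \<open>By alternation, a circuit meeting \<open>e\<close> at any end would contain
    \<open>e\<close>, and therefore \<open>v\<close>.\<close>
  have out': "a \<notin> \<Union>C" if "a \<in> e" "C \<in> \<D>" for a C
    using rd(3)[OF that(2) e(1) that(1)] out[OF that(2)] e(2) by blast
  have touch: "x = e" if x: "x \<in> gedges ?S" and a: "a \<in> x" "a \<in> e" for x a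
  proof -
    have "x \<in> M" using x out'[OF a(2)] a unfolding cover_def by auto
    moreover have "a \<in> gverts G" using edge_verts(1)[OF eG] a by blast
    ultimately show ?thesis using perfect_matching_unique[OF rd(1)] e a by blast
  qed
  have eS: "e \<in> gedges ?S" using e unfolding cover_def by simp
  have "{w \<in> gverts ?S. reachable_in ?S v w} = e"
  proof
    show "{w \<in> gverts ?S. reachable_in ?S v w} \<subseteq> e"
    proof
      fix w assume "w \<in> {w \<in> gverts ?S. reachable_in ?S v w}"
      then have "reachable_in ?S v w" by blast
      then show "w \<in> e" by (rule reachable_closed) (use e touch in blast)+
    qed
    show "e \<subseteq> {w \<in> gverts ?S. reachable_in ?S v w}"
      using edge_reachable[OF eS edge_verts(2)[OF eG] e(2)] edge_verts(1)[OF eG] unfolding cover_def by auto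
  qed
  moreover have "{x \<in> gedges ?S. x \<subseteq> e} = {e}"
  proof
    show "{e} \<subseteq> {x \<in> gedges ?S. x \<subseteq> e}" using eS by blast
    show "{x \<in> gedges ?S. x \<subseteq> e} \<subseteq> {e}"
    proof
      fix x assume x: "x \<in> {x \<in> gedges ?S. x \<subseteq> e}"
      then have "x \<in> gedges G" using matching_edges[OF rd(1)] rd(2) circuit_edges unfolding cover_def by auto
      then obtain a where "a \<in> x" using edge_verts(2) by fastforce
      then show "x \<in> {e}" using touch[of x a] x by blast
    qed
  qed
  ultimately show ?thesis unfolding induced_subgraph_on_def by simp
qed

lemma cover_components:
  assumes r: "resonant M \<D>"
  shows "graph_components (cover M \<D>) = (\<lambda>C. (\<Union>C, C)) ` \<D> \<union> (\<lambda>e. (e, {e})) ` (M - \<Union>\<D>)"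
proof
  note rd = resonantD[OF r]
  have gv: "gverts (cover M \<D>) = gverts G" unfolding cover_def by simp
  show "graph_components (cover M \<D>) \<subseteq> (\<lambda>C. (\<Union>C, C)) ` \<D> \<union> (\<lambda>e. (e, {e})) ` (M - \<Union>\<D>)"
  proof
    fix K assume "K \<in> graph_components (cover M \<D>)"
    then obtain v where v: "v \<in> gverts G" and K: "K = component (cover M \<D>) v"
      unfolding graph_components_def gv by blast
    show "K \<in> (\<lambda>C. (\<Union>C, C)) ` \<D> \<union> (\<lambda>e. (e, {e})) ` (M - \<Union>\<D>)"
    proof (cases "\<exists>C\<in>\<D>. v \<in> \<Union>C")
      case True
      then obtain C where C: "C \<in> \<D>" "v \<in> \<Union>C" by blast
      then show ?thesis using component_circuit[OF r C] K by blast
    next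
      case False
      obtain e where e: "e \<in> M" "v \<in> e" using perfect_matching_edge[OF rd(1) v] by blast
      then have "e \<notin> \<Union>\<D>" using False by blast
      moreover have "K = (e, {e})" using component_edge[OF r e] False K by blast
      ultimately show ?thesis using e by blast
    qed
  qed
  show "(\<lambda>C. (\<Union>C, C)) ` \<D> \<union> (\<lambda>e. (e, {e})) ` (M - \<Union>\<D>) \<subseteq> graph_components (cover M \<D>)"
  proof (intro Un_least image_subsetI)
    fix C assume C: "C \<in> \<D>"
    then have CC: "C \<in> \<C>" using rd(2) by blast
    obtain v where v: "v \<in> \<Union>C" using circuit_nonempty[OF CC] by blast
    show "(\<Union>C, C) \<in> graph_components (cover M \<D>)"
      unfolding graph_components_def gv component_circuit[OF r C v, symmetric]
      using circuit_verts[OF CC v] gv by auto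
  next
    fix e assume e: "e \<in> M - \<Union>\<D>"
    then have eG: "e \<in> gedges G" using matching_edges[OF rd(1)] by blast
    then obtain v where v: "v \<in> e" using edge_verts(2) by fastforce
    have eM: "e \<in> M" using e by blast
    have "v \<notin> \<Union>C" if "C \<in> \<D>" for C using rd(3)[OF that _ v] that e by blast
    from component_edge[OF r eM v this] show "(e, {e}) \<in> graph_components (cover M \<D>)"
      using v edge_verts(1)[OF eG] unfolding graph_components_def gv by (metis (no_types, lifting) gv image_eqI subsetD)
  qed
qed

text \<open>A single edge has ends of degree one and is no circuit, so the isolated matching edges
  are not counted and the size of \<D> can be read off from the cover alone.\<close>

lemma cover_cyc_components:
  assumes r: "resonant M \<D>"
  shows "graph_components (cover M \<D>) \<inter> cyc = (\<lambda>C. (\<Union>C, C)) ` \<D>"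
    "card (graph_components (cover M \<D>) \<inter> cyc) = card \<D>"
proof -
  have "(e, {e}) \<notin> cyc" for e using singleton_not_circuit[of e] unfolding cyc_def by auto
  moreover have "(\<lambda>C. (\<Union>C, C)) ` \<D> \<subseteq> cyc" using resonantD(2)[OF r] unfolding cyc_def by blast
  ultimately show "graph_components (cover M \<D>) \<inter> cyc = (\<lambda>C. (\<Union>C, C)) ` \<D>"
    unfolding cover_components[OF r] by blast
  then show "card (graph_components (cover M \<D>) \<inter> cyc) = card \<D>"
    by (simp add: card_image inj_on_def)
qed

text \<open>Clar covers with exactly \<open>k\<close> cycles, all taken from \<C>, stated without
  reference to a surface.\<close>

definition clar_covers :: "nat \<Rightarrow> 'v ugraph set" where
  "clar_covers k = {S. gverts S = gverts G \<and> gedges S \<subseteq> gedges G \<and>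
     (\<forall>K\<in>graph_components S. (\<exists>e\<in>gedges G. K = (e, {e})) \<or> K \<in> cyc) \<and>
     card (graph_components S \<inter> cyc) = k}"

text \<open>A Clar cover comes without a preferred matching. One is assembled from its single edges
  and, on every circuit component, the perfect matching supplied by the definition of
  \<open>circuit\<close>. Since components do not touch, the result is perfect on \<open>G\<close>,
  and the circuits are alternating and disjoint.\<close>

lemma clar_cover_is_cover:
  assumes gv: "gverts S = gverts G" and ge: "gedges S \<subseteq> gedges G"
    and comp: "\<And>K. K \<in> graph_components S \<Longrightarrow> (\<exists>e\<in>gedges G. K = (e, {e})) \<or> K \<in> cyc"
  obtains M \<D> where "resonant M \<D>" "S = cover M \<D>"
proof -
  have compI: "component S v \<in> graph_components S" if "v \<in> gverts G" for v
    using that gv unfolding graph_components_def by blast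
  have self: "v \<in> gverts (component S v)" if "v \<in> gverts G" for v
    using that gv reachable_refl unfolding induced_subgraph_on_def by simp
  have at: "x \<in> gedges (component S v)" if x: "x \<in> gedges S" "v \<in> x" for x v
  proof -
    have xG: "x \<in> gedges G" using x ge by blast
    show ?thesis unfolding induced_subgraph_on_def
      using edge_reachable[OF x(1) edge_verts(2)[OF xG] x(2)] edge_verts(1)[OF xG] gv x by auto
  qed
  have uniq: "K = component S v" if K: "K \<in> graph_components S" "v \<in> gverts K" for K v
  proof -
    obtain u where u: "K = component S u" using K unfolding graph_components_def by blast
    then have "reachable_in S u v" using K unfolding induced_subgraph_on_def by simp
    then have "reachable_in S u w \<longleftrightarrow> reachable_in S v w" for w
      using reachable_sym reachable_trans by metis
    then show ?thesis unfolding u by simp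
  qed
  have sub: "gedges K \<subseteq> gedges S" if "K \<in> graph_components S" for K
    using that unfolding graph_components_def induced_subgraph_on_def by auto
  define \<D> where "\<D> = {C\<in>\<C>. (\<Union>C, C) \<in> graph_components S}"
  have "\<forall>C\<in>\<C>. \<exists>A\<subseteq>C. \<forall>v\<in>\<Union>C. \<exists>!e. e \<in> A \<and> v \<in> e" using circuit unfolding circuit_def by simp
  then obtain A where A: "\<And>C. C \<in> \<C> \<Longrightarrow> A C \<subseteq> C"
    and A1: "\<And>C v. C \<in> \<C> \<Longrightarrow> v \<in> \<Union>C \<Longrightarrow> \<exists>!e. e \<in> A C \<and> v \<in> e" by metis
  define M where "M = {e\<in>gedges G. (e, {e}) \<in> graph_components S} \<union> (\<Union>C\<in>\<D>. A C)"
  have cases: "(\<exists>e\<in>gedges G. v \<in> e \<and> component S v = (e, {e}) \<and> (e, {e}) \<in> graph_components S) \<or>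
      (\<exists>C\<in>\<D>. v \<in> \<Union>C \<and> component S v = (\<Union>C, C))" if v: "v \<in> gverts G" for v
  proof (cases "component S v \<in> cyc")
    case True
    then obtain C where "C \<in> \<C>" "component S v = (\<Union>C, C)" unfolding cyc_def by blast
    then show ?thesis using self[OF v] compI[OF v] unfolding \<D>_def by (metis (mono_tags, lifting) fst_conv mem_Collect_eq)
  next
    case False
    then show ?thesis using comp[OF compI[OF v]] self[OF v] compI[OF v] by (metis fst_conv)
  qed
  have Dcomp: "component S v = (\<Union>C, C)" if "C \<in> \<D>" "v \<in> \<Union>C" for C v
    using uniq[of "(\<Union>C, C)" v] that unfolding \<D>_def by simp
  have Ecomp: "component S v = (e, {e})" if "(e, {e}) \<in> graph_components S" "v \<in> e" for e v
    using uniq[of "(e, {e})" v] that by simp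
  have DC: "\<D> \<subseteq> \<C>" unfolding \<D>_def by blast
  have SM: "gedges S = M \<union> \<Union>\<D>"
  proof
    show "M \<union> \<Union>\<D> \<subseteq> gedges S"
    proof -
      have "C \<subseteq> gedges S" if "C \<in> \<D>" for C using sub[of "(\<Union>C, C)"] that unfolding \<D>_def by simp
      moreover have "e \<in> gedges S" if "(e, {e}) \<in> graph_components S" for e using sub[OF that] by simp
      ultimately show ?thesis unfolding M_def using A DC by blast
    qed
    show "gedges S \<subseteq> M \<union> \<Union>\<D>"
    proof
      fix x assume x: "x \<in> gedges S"
      then have xG: "x \<in> gedges G" using ge by blast
      then obtain v where v: "v \<in> x" using edge_verts(2) by fastforce
      have vG: "v \<in> gverts G" using edge_verts(1)[OF xG] v by blast
      have xc: "x \<in> gedges (component S v)" by (rule at[OF x v])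
      from cases[OF vG] show "x \<in> M \<union> \<Union>\<D>"
      proof
        assume "\<exists>e\<in>gedges G. v \<in> e \<and> component S v = (e, {e}) \<and> (e, {e}) \<in> graph_components S"
        then obtain e where e: "e \<in> gedges G" "component S v = (e, {e})" "(e, {e}) \<in> graph_components S" by blast
        then have "x = e" using xc by simp
        then show ?thesis using e unfolding M_def by blast
      next
        assume "\<exists>C\<in>\<D>. v \<in> \<Union>C \<and> component S v = (\<Union>C, C)"
        then show ?thesis using xc by fastforce
      qed
    qed
  qed
  have pm: "perfect_matching G M" unfolding perfect_matching_def
  proof (intro conjI ballI)
    show "M \<subseteq> gedges G" using SM ge by blast
    fix v assume v: "v \<in> gverts G"
    from cases[OF v] show "\<exists>!x. x \<in> M \<and> v \<in> x"
    proof
      assume "\<exists>e\<in>gedges G. v \<in> e \<and> component S v = (e, {e}) \<and> (e, {e}) \<in> graph_components S"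
      then obtain e where e: "e \<in> gedges G" "v \<in> e" "component S v = (e, {e})" "(e, {e}) \<in> graph_components S" by blast
      show ?thesis
      proof (rule ex1I[of _ e])
        show "e \<in> M \<and> v \<in> e" using e unfolding M_def by blast
        fix x assume x: "x \<in> M \<and> v \<in> x"
        then have "x \<in> gedges (component S v)" using at[of x v] SM by blast
        then show "x = e" using e by simp
      qed
    next
      assume "\<exists>C\<in>\<D>. v \<in> \<Union>C \<and> component S v = (\<Union>C, C)"
      then obtain C where C: "C \<in> \<D>" "v \<in> \<Union>C" "component S v = (\<Union>C, C)" by blast
      then have CC: "C \<in> \<C>" using DC by blast
      obtain a where a: "a \<in> A C" "v \<in> a" "\<And>x. x \<in> A C \<Longrightarrow> v \<in> x \<Longrightarrow> x = a" using A1[OF CC C(2)] by metis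
      show ?thesis
      proof (rule ex1I[of _ a])
        show "a \<in> M \<and> v \<in> a" using a C unfolding M_def by blast
        fix x assume x: "x \<in> M \<and> v \<in> x"
        then consider "(x, {x}) \<in> graph_components S" | C' where "C' \<in> \<D>" "x \<in> A C'" unfolding M_def by blast
        then show "x = a"
        proof cases
          case 1
          then have "(\<Union>C, C) = (x, {x})" using Ecomp[OF 1, of v] x unfolding C(3) by blast
          then have "C = {x}" by (rule Pair_inject)
          then show ?thesis using CC singleton_not_circuit by blast
        next
          case 2
          have "v \<in> \<Union>C'" using 2 A DC x by blast
          from Dcomp[OF 2(1) this] have "C' = C" unfolding C(3) by simp
          then show ?thesis using a 2 x by blast
        qed
      qed
    qed
  qed
  have "resonant M \<D>" unfolding resonant_def
  proof (intro conjI ballI impI pm DC)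
    fix C e assume C: "C \<in> \<D>" and e: "e \<in> M" "e \<inter> \<Union>C \<noteq> {}"
    then obtain v where v: "v \<in> e" "v \<in> \<Union>C" by blast
    have "e \<in> gedges (component S v)" using at[of e v] SM e v by blast
    then show "e \<in> C" using Dcomp[OF C v(2)] by simp
  next
    fix C C' assume C: "C \<in> \<D>" "C' \<in> \<D>" "C \<noteq> C'"
    show "\<Union>C \<inter> \<Union>C' = {}"
    proof (rule ccontr)
      assume "\<Union>C \<inter> \<Union>C' \<noteq> {}"
      then obtain v where v: "v \<in> \<Union>C" "v \<in> \<Union>C'" by blast
      then show False using Dcomp[OF C(1) v(1)] Dcomp[OF C(2) v(2)] C(3) by simp
    qed
  qed
  moreover have "S = cover M \<D>" unfolding cover_def using SM gv by (metis prod.collapse)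
  ultimately show thesis by (rule that)
qed

lemma clar_covers_eq: "clar_covers k = {cover M \<D> | M \<D>. resonant M \<D> \<and> card \<D> = k}"
proof (rule set_eqI)
  fix S
  show "S \<in> clar_covers k \<longleftrightarrow> S \<in> {cover M \<D> | M \<D>. resonant M \<D> \<and> card \<D> = k}"
  proof
    assume "S \<in> clar_covers k"
    then have S: "gverts S = gverts G" "gedges S \<subseteq> gedges G"
      "\<And>K. K \<in> graph_components S \<Longrightarrow> (\<exists>e\<in>gedges G. K = (e, {e})) \<or> K \<in> cyc"
      "card (graph_components S \<inter> cyc) = k" unfolding clar_covers_def by auto
    obtain M \<D> where "resonant M \<D>" "S = cover M \<D>" using clar_cover_is_cover[OF S(1-3)] by blast
    moreover from this have "card \<D> = k" using cover_cyc_components(2)[of M \<D>] S(4) by simp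
    ultimately show "S \<in> {cover M \<D> | M \<D>. resonant M \<D> \<and> card \<D> = k}" by blast
  next
    assume "S \<in> {cover M \<D> | M \<D>. resonant M \<D> \<and> card \<D> = k}"
    then obtain M \<D> where S: "S = cover M \<D>" "resonant M \<D>" "card \<D> = k" by blast
    note rd = resonantD[OF S(2)]
    have "(\<exists>e\<in>gedges G. K = (e, {e})) \<or> K \<in> cyc" if "K \<in> graph_components S" for K
      using that matching_edges[OF rd(1)] rd(2) unfolding S cover_components[OF S(2)] cyc_def by blast
    moreover have "gedges S \<subseteq> gedges G"
      using matching_edges[OF rd(1)] rd(2) circuit_edges unfolding S cover_def by auto
    ultimately show "S \<in> clar_covers k"
      using cover_cyc_components(2)[OF S(2)] S unfolding clar_covers_def by (auto simp: cover_def)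
  qed
qed

end

section \<open>Induced cubes of the resonance graph\<close>

context resonant_graph
begin

abbreviation cube_of :: "'v ugraph \<Rightarrow> 'v set set ugraph" where
  "cube_of S \<equiv> induced_subgraph_on resonance (matchings_in S)"

lemma sym_diff_flips:
  assumes r: "resonant M \<D>" and J: "J \<subseteq> \<D>" "J' \<subseteq> \<D>"
  shows "sym_diff (sym_diff M (\<Union>J)) (sym_diff M (\<Union>J')) = \<Union>(sym_diff J J')"
proof -
  have u: "C = C'" if "C \<in> J \<union> J'" "C' \<in> J \<union> J'" "e \<in> C" "e \<in> C'" for C C' e
    using edge_in_unique_circuit[OF r _ _ that(3,4)] that(1,2) J by blast
  have "\<Union>(sym_diff J J') = sym_diff (\<Union>J) (\<Union>J')"
  proof (rule set_eqI)
    fix e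
    show "e \<in> \<Union>(sym_diff J J') \<longleftrightarrow> e \<in> sym_diff (\<Union>J) (\<Union>J')"
    proof (cases "\<exists>C\<in>J \<union> J'. e \<in> C")
      case False then show ?thesis by auto
    next
      case True
      then obtain C where C: "C \<in> J \<union> J'" "e \<in> C" by blast
      have "e \<in> \<Union>K \<longleftrightarrow> C \<in> K" if "K \<subseteq> J \<union> J'" for K using u[OF C(1) _ C(2)] C(2) that by blast
      from this[of J] this[of J'] this[of "sym_diff J J'"] show ?thesis by auto
    qed
  qed
  then show ?thesis by auto
qed

text \<open>Disjoint circuits do not touch, so each member of \<open>J\<close> is closed under
  touching inside the union and must be all of it if the union is a circuit. This is why the cubes
  are induced: matchings that differ by several switches are not adjacent through any member of
  \<C>, whether in \<D> or not.\<close>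

lemma Union_circuits_is_circuit:
  assumes r: "resonant M \<D>" and J: "J \<subseteq> \<D>"
  shows "\<Union>J \<in> \<C> \<longleftrightarrow> card J = 1"
proof
  note rd = resonantD[OF r]
  assume U: "\<Union>J \<in> \<C>"
  have eq: "C = \<Union>J" if C: "C \<in> J" for C
  proof (rule circuit_connected[OF circuit[OF U]])
    show "C \<subseteq> \<Union>J" using C by blast
    show "C \<noteq> {}" using circuit_nonempty[of C] C J rd(2) by blast
    fix e e' assume e: "e \<in> C" "e' \<in> \<Union>J" "e \<inter> e' \<noteq> {}"
    obtain C' where C': "C' \<in> J" "e' \<in> C'" using e by blast
    obtain v where v: "v \<in> e" "v \<in> e'" using e by blast
    have "C = C'" using rd(4)[of C C' v] C C' J e v by blast
    then show "e' \<in> C" using C' by blast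
  qed
  moreover have "J \<noteq> {}" using circuit_nonempty[OF U] by auto
  ultimately have "J = {\<Union>J}" by blast
  then show "card J = 1" by (metis card_1_singleton_iff One_nat_def)
next
  assume "card J = 1"
  then obtain C where "J = {C}" by (metis card_1_singletonE)
  then show "\<Union>J \<in> \<C>" using J resonantD(2)[OF r] by auto
qed

lemma finite_resonant: "resonant M \<D> \<Longrightarrow> finite \<D>"
  using resonantD(2) finite_circuits finite_subset by blast

lemma cube_of_cover:
  assumes r: "resonant M \<D>"
  shows "graph_isomorphic (cube_of (cover M \<D>)) (hypercube (card \<D>))"
  unfolding hypercube_iso_subsets[OF finite_resonant[OF r] refl]
proof (intro exI[of _ "\<lambda>J. sym_diff M (\<Union>J)"] conjI ballI)
  note rd = resonantD[OF r]
  have inj: "inj_on (\<lambda>J. sym_diff M (\<Union>J)) (Pow \<D>)"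
  proof (rule inj_onI)
    fix J J' assume J: "J \<in> Pow \<D>" "J' \<in> Pow \<D>" and eq: "sym_diff M (\<Union>J) = sym_diff M (\<Union>J')"
    have "\<Union>(sym_diff J J') = {}" using sym_diff_flips[OF r, of J J'] J unfolding eq by simp
    moreover have "C \<noteq> {}" if "C \<in> sym_diff J J'" for C using circuit_nonempty[of C] that J rd(2) by blast
    ultimately have "sym_diff J J' = {}" by blast
    then show "J = J'" by blast
  qed
  show "bij_betw (\<lambda>J. sym_diff M (\<Union>J)) (Pow \<D>) (gverts (cube_of (cover M \<D>)))"
    unfolding bij_betw_def induced_subgraph_on_def using inj matchings_in_cover[OF r] by simp
  fix J J' assume J: "J \<in> Pow \<D>" "J' \<in> Pow \<D>"
  let ?N = "sym_diff M (\<Union>J)" and ?N' = "sym_diff M (\<Union>J')"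
  have pm: "perfect_matching G ?N" "perfect_matching G ?N'" using perfect_matching_flip[OF r] J by blast+
  have "?N \<in> matchings_in (cover M \<D>)" "?N' \<in> matchings_in (cover M \<D>)" unfolding matchings_in_cover[OF r] using J by blast+
  then have "{?N, ?N'} \<in> gedges (cube_of (cover M \<D>)) \<longleftrightarrow> {?N, ?N'} \<in> gedges resonance"
    unfolding induced_subgraph_on_def by simp
  also have "\<dots> \<longleftrightarrow> \<Union>(sym_diff J J') \<in> \<C>"
    unfolding resonance_edge[OF pm] sym_diff_flips[OF r PowD[OF J(1)] PowD[OF J(2)]] ..
  also have "\<dots> \<longleftrightarrow> card (sym_diff J J') = 1"
    by (rule Union_circuits_is_circuit[OF r]) (use J in blast)
  finally show "{?N, ?N'} \<in> gedges (cube_of (cover M \<D>)) \<longleftrightarrow> card (sym_diff J J') = 1" .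
qed

text \<open>The corner \<open>\<phi> {}\<close> serves as \<open>M\<close>, and direction
  \<open>i\<close> receives the circuit \<open>D i\<close> on the edge from \<open>{}\<close> to
  \<open>{i}\<close>. By \<open>square\<close> the circuit of a direction does not change when the
  edge is moved across a two-dimensional face, so it is constant on the whole cube; the same lemma,
  applied at the corner \<open>{}\<close>, makes different directions disjoint.\<close>

lemma cube_is_cube_of_cover:
  assumes W: "W \<subseteq> gverts resonance"
    and iso: "graph_isomorphic (induced_subgraph_on resonance W) (hypercube n)"
  obtains M \<D> where "resonant M \<D>" "card \<D> = n" "W = matchings_in (cover M \<D>)"
proof -
  obtain \<phi> where bij: "bij_betw \<phi> (Pow {..<n}) W"
    and adj: "\<And>A B. A \<subseteq> {..<n} \<Longrightarrow> B \<subseteq> {..<n} \<Longrightarrow>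
      {\<phi> A, \<phi> B} \<in> gedges (induced_subgraph_on resonance W) \<longleftrightarrow> card (sym_diff A B) = 1"
    using iso unfolding hypercube_iso_subsets[OF finite_lessThan card_lessThan]
    by (auto simp: induced_subgraph_on_def)
  have inW: "\<phi> A \<in> W" if "A \<subseteq> {..<n}" for A using bij_betwE[OF bij] that by blast
  have pm: "perfect_matching G (\<phi> A)" if "A \<subseteq> {..<n}" for A
    using inW[OF that] W unfolding resonance_def by auto
  have inj: "A = B" if "\<phi> A = \<phi> B" "A \<subseteq> {..<n}" "B \<subseteq> {..<n}" for A B
    using bij that unfolding bij_betw_def inj_on_def by blast
  have adjC: "sym_diff (\<phi> A) (\<phi> B) \<in> \<C>" if "A \<subseteq> {..<n}" "B \<subseteq> {..<n}" "card (sym_diff A B) = 1" for A B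
    using adj[OF that(1,2)] that(3) resonance_edge[OF pm[OF that(1)] pm[OF that(2)]]
    unfolding induced_subgraph_on_def by simp
  have step: "sym_diff (\<phi> A) (\<phi> (insert i A)) \<in> \<C>" "sym_diff (\<phi> (insert i A)) (\<phi> A) \<in> \<C>"
    if "A \<subseteq> {..<n}" "i < n" "i \<notin> A" for A i
  proof -
    have "sym_diff A (insert i A) = {i}" "sym_diff (insert i A) A = {i}" using that by auto
    then show "sym_diff (\<phi> A) (\<phi> (insert i A)) \<in> \<C>" "sym_diff (\<phi> (insert i A)) (\<phi> A) \<in> \<C>"
      using adjC[of A "insert i A"] adjC[of "insert i A" A] that by simp_all
  qed
  have sq: "sym_diff (\<phi> (insert j A)) (\<phi> (insert i (insert j A))) = sym_diff (\<phi> A) (\<phi> (insert i A))"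
    "\<Union>(sym_diff (\<phi> A) (\<phi> (insert i A))) \<inter> \<Union>(sym_diff (\<phi> A) (\<phi> (insert j A))) = {}"
    if A: "A \<subseteq> {..<n}" and ij: "i < n" "j < n" "i \<noteq> j" "i \<notin> A" "j \<notin> A" for A i j
  proof -
    let ?M1 = "\<phi> A" and ?M2 = "\<phi> (insert i A)" and ?M3 = "\<phi> (insert i (insert j A))" and ?M4 = "\<phi> (insert j A)"
    have s: "insert i A \<subseteq> {..<n}" "insert j A \<subseteq> {..<n}" "insert i (insert j A) \<subseteq> {..<n}" using A ij by auto
    have ne: "?M1 \<noteq> ?M3" "?M2 \<noteq> ?M4"
      using inj[of A "insert i (insert j A)"] inj[of "insert i A" "insert j A"] A s ij by blast+
    have c: "sym_diff ?M2 ?M3 \<in> \<C>" "sym_diff ?M3 ?M4 \<in> \<C>"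
      using step(1)[of "insert i A" j] step(2)[of "insert j A" i] A s ij by (simp_all add: insert_commute)
    note q = square[OF pm[OF A] pm[OF s(1)] pm[OF s(3)] pm[OF s(2)] step(1)[OF A ij(1,4)] c step(2)[OF A ij(2,5)] ne]
    have sw: "sym_diff X Y = sym_diff Y X" for X Y :: "'v set set" by blast
    show "sym_diff ?M4 ?M3 = sym_diff ?M1 ?M2" using q(1) unfolding sw[of ?M4 ?M3] .
    show "\<Union>(sym_diff ?M1 ?M2) \<inter> \<Union>(sym_diff ?M1 ?M4) = {}" using q(2) unfolding sw[of ?M4 ?M1] .
  qed
  define M where "M = \<phi> {}"
  define D where "D i = sym_diff (\<phi> {}) (\<phi> {i})" for i
  have DC: "D i \<in> \<C>" if "i < n" for i using step(1)[of "{}" i] that unfolding D_def by simp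
  have Ddisj: "\<Union>(D i) \<inter> \<Union>(D j) = {}" if "i < n" "j < n" "i \<noteq> j" for i j
    using sq(2)[of "{}" i j] that unfolding D_def by simp
  have Ddisj': "D i \<inter> D j = {}" if ij: "i < n" "j < n" "i \<noteq> j" for i j
  proof (rule ccontr)
    assume "D i \<inter> D j \<noteq> {}"
    then obtain e where e: "e \<in> D i" "e \<in> D j" by blast
    then have "card e = 2" using DC[OF ij(1)] circuit_edges edge_verts by blast
    then have "e \<noteq> {}" by auto
    then show False using Ddisj[OF ij] e by blast
  qed
  \<comment> \<open>Each element added to \<open>A\<close> moves the edge in direction
    \<open>i\<close> across one square.\<close>
  have dir: "sym_diff (\<phi> A) (\<phi> (insert i A)) = D i" if "A \<subseteq> {..<n}" "i < n" "i \<notin> A" for A i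
  proof -
    have "finite A" using that finite_subset by blast
    then show ?thesis using that
    proof (induction A rule: finite_induct)
      case empty then show ?case unfolding D_def by simp
    next
      case (insert j A)
      then show ?case using sq(1)[of A i j] by simp
    qed
  qed
  have phi: "\<phi> A = sym_diff M (\<Union>(D ` A))" if "A \<subseteq> {..<n}" for A
  proof -
    have "finite A" using that finite_subset by blast
    then show ?thesis using that
    proof (induction A rule: finite_induct)
      case empty then show ?case unfolding M_def by simp
    next
      case (insert i A)
      have "sym_diff (\<phi> A) (\<phi> (insert i A)) = D i"
        by (rule dir) (use insert.hyps insert.prems in simp_all)
      then have "\<phi> (insert i A) = sym_diff (\<phi> A) (D i)" by blast
      also have "\<dots> = sym_diff (sym_diff M (\<Union>(D ` A))) (D i)" using insert by simp
      also have "\<dots> = sym_diff M (\<Union>(D ` insert i A))"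
      proof -
        have "D i \<inter> D j = {}" if "j \<in> A" for j using Ddisj'[of i j] insert that by auto
        then have "D i \<inter> \<Union>(D ` A) = {}" by blast
        then show ?thesis by auto
      qed
      finally show ?case .
    qed
  qed
  have r: "resonant M (D ` {..<n})" unfolding resonant_def
  proof (intro conjI ballI impI)
    show "perfect_matching G M" unfolding M_def by (rule pm) simp
    show "D ` {..<n} \<subseteq> \<C>" using DC by blast
  next
    fix C e assume C: "C \<in> D ` {..<n}" and e: "e \<in> M" "e \<inter> \<Union>C \<noteq> {}"
    then obtain i where i: "i < n" "C = D i" by blast
    obtain v where v: "v \<in> e" "v \<in> \<Union>C" using e by blast
    \<comment> \<open>Being the difference of two perfect matchings, one of them \<open>M\<close>,
      makes \<open>D i\<close> alternating for \<open>M\<close>.\<close>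
    have "e \<in> sym_diff (\<phi> {}) (\<phi> {i})"
    proof (rule alternating)
      show "perfect_matching G (\<phi> {})" "perfect_matching G (\<phi> {i})" using pm i by simp_all
      show "sym_diff (\<phi> {}) (\<phi> {i}) \<in> \<C>" using DC[OF i(1)] unfolding D_def .
      show "v \<in> \<Union>(sym_diff (\<phi> {}) (\<phi> {i}))" using v(2) unfolding i D_def .
      show "e \<in> \<phi> {} \<union> \<phi> {i}" using e unfolding M_def by blast
    qed (rule v(1))
    then show "e \<in> C" unfolding i D_def .
  next
    fix C C' assume C: "C \<in> D ` {..<n}" "C' \<in> D ` {..<n}" "C \<noteq> C'"
    then obtain i j where ij: "i < n" "j < n" "C = D i" "C' = D j" by blast
    then have "i \<noteq> j" using C by blast
    then show "\<Union>C \<inter> \<Union>C' = {}" using Ddisj ij by simp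
  qed
  have "inj_on D {..<n}"
  proof (rule inj_onI)
    fix i j assume ij: "i \<in> {..<n}" "j \<in> {..<n}" "D i = D j"
    show "i = j"
    proof (rule ccontr)
      assume "i \<noteq> j"
      then have "\<Union>(D i) = {}" using Ddisj[of i j] ij by auto
      then show False using circuit_nonempty[OF DC[of i]] ij(1) by blast
    qed
  qed
  then have "card (D ` {..<n}) = n" by (simp add: card_image)
  moreover have "W = matchings_in (cover M (D ` {..<n}))"
  proof -
    have "W = \<phi> ` Pow {..<n}" using bij unfolding bij_betw_def by simp
    also have "\<dots> = (\<lambda>A. sym_diff M (\<Union>(D ` A))) ` Pow {..<n}" by (rule image_cong) (use phi in auto)
    also have "\<dots> = (\<lambda>J. sym_diff M (\<Union>J)) ` ((`) D ` Pow {..<n})" unfolding image_image ..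
    also have "(`) D ` Pow {..<n} = Pow (D ` {..<n})" by (rule image_Pow_surj) (rule refl)
    finally show ?thesis unfolding matchings_in_cover[OF r] .
  qed
  ultimately show thesis using that[OF r] by blast
qed

lemma card_clar_covers: "card (clar_covers k) = induced_cube_count resonance k"
proof -
  have inj: "inj_on cube_of (clar_covers k)"
  proof (rule inj_onI)
    fix S S' assume S: "S \<in> clar_covers k" "S' \<in> clar_covers k" and eq: "cube_of S = cube_of S'"
    obtain M \<D> where 1: "S = cover M \<D>" "resonant M \<D>" using S(1) unfolding clar_covers_eq by blast
    obtain M' \<D>' where 2: "S' = cover M' \<D>'" "resonant M' \<D>'" using S(2) unfolding clar_covers_eq by blast
    have "matchings_in S = matchings_in S'" using eq unfolding induced_subgraph_on_def by simp
    then have "gedges S = gedges S'"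
      using Union_matchings_in_cover[OF 1(2)] Union_matchings_in_cover[OF 2(2)] 1(1) 2(1) by simp
    then show "S = S'" unfolding 1(1) 2(1) cover_def by simp
  qed
  have "cube_of ` clar_covers k =
      {K. (\<exists>W\<subseteq>gverts resonance. K = induced_subgraph_on resonance W) \<and> graph_isomorphic K (hypercube k)}"
    (is "?L = ?R")
  proof
    show "?L \<subseteq> ?R"
    proof (rule image_subsetI)
      fix S assume "S \<in> clar_covers k"
      then obtain M \<D> where S: "S = cover M \<D>" "resonant M \<D>" "card \<D> = k" unfolding clar_covers_eq by blast
      have "matchings_in S \<subseteq> gverts resonance" unfolding matchings_in_def resonance_def by auto
      then show "cube_of S \<in> ?R" using cube_of_cover[OF S(2)] S(1,3) by auto
    qed
    show "?R \<subseteq> ?L"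
    proof
      fix K assume "K \<in> ?R"
      then obtain W where W: "W \<subseteq> gverts resonance" "K = induced_subgraph_on resonance W"
        and iso: "graph_isomorphic K (hypercube k)" by blast
      obtain M \<D> where "resonant M \<D>" "card \<D> = k" "W = matchings_in (cover M \<D>)"
        using cube_is_cube_of_cover[OF W(1)] iso W(2) by metis
      then show "K \<in> ?L" unfolding W(2) clar_covers_eq by blast
    qed
  qed
  then show ?thesis unfolding induced_cube_count_def using card_image[OF inj] by simp
qed

end

section \<open>Arcs in surfaces are locally two-sided\<close>

text \<open>
  Follow the arc from \<open>g u\<close> in both directions until it first leaves the disc, and close this
  crosscut up along the circle to a Jordan curve. Two of the three points lie on the same side of it;
  Janiszewski's theorem lets one add the rest of the arc and the exterior of the disc, since these meet
  the curve in the circular arc only, which is connected.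
\<close>

lemma planar_two_sides:
  fixes g :: "real \<Rightarrow> complex"
  assumes cont: "continuous_on {a..b} g" and inj: "inj_on g {a..b}" and au: "a < u" and ub: "u < b"
    and r: "0 < r" and ga: "g a \<notin> ball (g u) r" and gb: "g b \<notin> ball (g u) r"
  obtains \<epsilon> where "0 < \<epsilon>" "\<epsilon> \<le> r"
    "\<And>x y z. {x, y, z} \<subseteq> ball (g u) \<epsilon> - g ` {a..b} \<Longrightarrow>
      connected_component (ball (g u) r - g ` {a..b}) x y \<or>
      connected_component (ball (g u) r - g ` {a..b}) y z \<or>
      connected_component (ball (g u) r - g ` {a..b}) x z"
proof -
  let ?B = "ball (g u) r"
  have contsub: "continuous_on {c..d} g" if "a \<le> c" "d \<le> b" for c d
    by (rule continuous_on_subset[OF cont]) (use that in auto)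
  have cl: "closed ({c..d} \<inter> g -` (- ?B))" if "a \<le> c" "d \<le> b" for c d
    by (rule continuous_closed_preimage[OF contsub[OF that]]) auto
  define s where "s = Sup ({a..u} \<inter> g -` (- ?B))"
  define t where "t = Inf ({u..b} \<inter> g -` (- ?B))"
  have bd: "bdd_above ({a..u} \<inter> g -` (- ?B))" "bdd_below ({u..b} \<inter> g -` (- ?B))" by auto
  have "a \<in> {a..u} \<inter> g -` (- ?B)" "b \<in> {u..b} \<inter> g -` (- ?B)" using ga gb au ub by simp_all
  then have ne: "{a..u} \<inter> g -` (- ?B) \<noteq> {}" "{u..b} \<inter> g -` (- ?B) \<noteq> {}" by blast+
  have s: "s \<in> {a..u} \<inter> g -` (- ?B)" unfolding s_def
    by (rule closed_contains_Sup) (use ne au ub bd cl in auto)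
  have t: "t \<in> {u..b} \<inter> g -` (- ?B)" unfolding t_def
    by (rule closed_contains_Inf) (use ne au ub bd cl in auto)
  have "s \<noteq> u" "t \<noteq> u" using s t r by auto
  then have su: "a \<le> s" "s < u" and tu: "u < t" "t \<le> b" using s t by auto
  have out_s: "g s \<notin> ?B" and out_t: "g t \<notin> ?B" using s t by auto
  have inB: "g x \<in> ?B" if x: "s < x" "x < t" for x
  proof (rule ccontr)
    assume n: "g x \<notin> ?B"
    show False
    proof (cases "x \<le> u")
      case True
      then have "x \<le> s" unfolding s_def using n x su by (intro cSup_upper[OF _ bd(1)]) auto
      then show False using x by simp
    next
      case False
      then have "t \<le> x" unfolding t_def using n x tu by (intro cInf_lower[OF _ bd(2)]) auto
      then show False using x by simp
    qed
  qed
  \<comment> \<open>By continuity the ends of the crosscut lie in the closed disc; being outside the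
    open one, they are on the circle.\<close>
  have lim: "g w \<in> cball (g u) r" if w: "w \<in> {s..t}" for w
  proof -
    have "g ` closure {s<..<t} \<subseteq> closure (g ` {s<..<t})"
    proof (rule image_closure_subset)
      show "continuous_on (closure {s<..<t}) g"
        using contsub[of s t] su tu by simp
      show "closed (closure (g ` {s<..<t}))" "g ` {s<..<t} \<subseteq> closure (g ` {s<..<t})"
        by (simp_all add: closure_subset)
    qed
    moreover have "g ` {s<..<t} \<subseteq> ?B" using inB by auto
    then have "closure (g ` {s<..<t}) \<subseteq> cball (g u) r"
      using ball_subset_cball by (intro closure_minimal) (blast, simp)
    moreover have "w \<in> closure {s<..<t}" using w su tu by simp
    ultimately show ?thesis by blast
  qed
  have sph: "g s \<in> sphere (g u) r" "g t \<in> sphere (g u) r"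
    using lim[of s] lim[of t] out_s out_t su tu by auto
  have st_ne: "g t \<noteq> g s"
  proof
    assume "g t = g s"
    then have "t = s" using inj su tu by (auto dest!: inj_onD)
    then show False using su tu by simp
  qed
  \<comment> \<open>Either of the two circular arcs between the ends serves to close the
    curve.\<close>
  obtain d where d: "arc d" "path_image d \<subseteq> sphere (g u) r" "pathstart d = g t" "pathfinish d = g s"
  proof -
    have "path_connected (sphere (g u) r)" by (rule path_connected_sphere) simp
    then show thesis using that sph st_ne unfolding path_connected_arcwise by metis
  qed
  define h where "h = (\<lambda>x. g (s + (t - s) * x))"
  have rep: "(\<lambda>x. s + (t - s) * x) ` {0..1} = {s..t}"
  proof
    show "{s..t} \<subseteq> (\<lambda>x. s + (t - s) * x) ` {0..1}"
    proof
      fix x assume "x \<in> {s..t}"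
      then show "x \<in> (\<lambda>x. s + (t - s) * x) ` {0..1}"
        using su tu by (intro image_eqI[of _ _ "(x - s) / (t - s)"]) (auto simp: field_simps)
    qed
    show "(\<lambda>x. s + (t - s) * x) ` {0..1} \<subseteq> {s..t}"
    proof (rule image_subsetI)
      fix x :: real assume "x \<in> {0..1}"
      then have "0 \<le> (t - s) * x" "(t - s) * x \<le> (t - s) * 1" using su tu by (auto intro: mult_left_mono)
      then show "s + (t - s) * x \<in> {s..t}" by simp
    qed
  qed
  have him: "path_image h = g ` {s..t}" unfolding path_image_def h_def using rep by (metis image_image)
  have hends: "pathstart h = g s" "pathfinish h = g t" unfolding h_def pathstart_def pathfinish_def by auto
  have "arc h" unfolding arc_def path_def
  proof
    show "continuous_on {0..1} h" unfolding h_def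
    proof (rule continuous_on_compose2[of "{a..b}" g])
      show "(\<lambda>x. s + (t - s) * x) ` {0..1} \<subseteq> {a..b}" unfolding rep using su tu by auto
    qed (auto intro!: continuous_intros cont)
    show "inj_on h {0..1}"
    proof (rule inj_onI)
      fix x y :: real assume xy: "x \<in> {0..1}" "y \<in> {0..1}" "h x = h y"
      have "s + (t - s) * x \<in> {s..t}" "s + (t - s) * y \<in> {s..t}" using rep xy by blast+
      moreover have "{s..t} \<subseteq> {a..b}" using su tu by auto
      ultimately have "s + (t - s) * x = s + (t - s) * y" using xy(3) inj_onD[OF inj] unfolding h_def by blast
      then show "x = y" using su tu by simp
    qed
  qed
  have sp: "simple_path (h +++ d)"
  proof (rule simple_path_join_loop[OF \<open>arc h\<close> d(1)])
    have "g x \<in> {g s, g t}" if "x \<in> {s..t}" "g x \<in> sphere (g u) r" for x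
      using inB[of x] that by (cases "x = s \<or> x = t") auto
    then show "path_image h \<inter> path_image d \<subseteq> {pathstart h, pathstart d}"
      unfolding him hends d(3) using d(2) by blast
  qed (use d hends in auto)
  have J: "path_image (h +++ d) = g ` {s..t} \<union> path_image d" using d hends him by (simp add: path_image_join)
  \<comment> \<open>Everything besides the Jordan curve that has to be avoided: the outside of the
    disc and the two remaining pieces of the arc, which may return to the disc but stay away from
    \<open>g u\<close>.\<close>
  define R where "R = - ?B \<union> g ` {a..s} \<union> g ` {t..b}"
  have compg: "compact (g ` {c..d'})" if "a \<le> c" "d' \<le> b" for c d'
    by (rule compact_continuous_image[OF contsub[OF that]]) auto
  have "closed R" unfolding R_def
    using compg[of a s] compg[of t b] su tu by (intro closed_Un) (auto simp: compact_imp_closed closed_Compl)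
  have Rout: "g x \<notin> R" if x: "s < x" "x < t" for x
  proof
    assume "g x \<in> R"
    then obtain x' where x': "x' \<in> {a..s} \<union> {t..b}" "g x = g x'" using inB[OF x] unfolding R_def by blast
    moreover have "x \<in> {a..b}" "x' \<in> {a..b}" using x x' su tu by auto
    ultimately have "x = x'" using inj_onD[OF inj] by blast
    then show False using x' x by auto
  qed
  then have "g u \<notin> R" using su tu by blast
  then obtain \<epsilon> where \<epsilon>: "0 < \<epsilon>" "ball (g u) \<epsilon> \<subseteq> - R"
    using \<open>closed R\<close> open_contains_ball[of "- R"] by (auto simp: closed_def)
  have int: "path_image (h +++ d) \<inter> R = path_image d"
  proof
    show "path_image d \<subseteq> path_image (h +++ d) \<inter> R" using d(2) unfolding J R_def by auto
    have "g x \<in> path_image d" if x: "x \<in> {s..t}" "g x \<in> R" for x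
    proof (cases "x = s \<or> x = t")
      case True
      then show ?thesis using d(3,4) by (metis pathfinish_in_path_image pathstart_in_path_image)
    next
      case False
      then show ?thesis using Rout[of x] x by auto
    qed
    then show "path_image (h +++ d) \<inter> R \<subseteq> path_image d" unfolding J by auto
  qed
  have whole: "- (path_image (h +++ d) \<union> R) \<subseteq> ?B - g ` {a..b}"
  proof -
    have "{a..b} = {a..s} \<union> {s..t} \<union> {t..b}" using su tu by auto
    then have "g ` {a..b} = g ` {a..s} \<union> g ` {s..t} \<union> g ` {t..b}" by (metis image_Un)
    then show ?thesis unfolding J R_def by auto
  qed
  have loop: "pathfinish (h +++ d) = pathstart (h +++ d)" using d hends by simp
  note jordan = Jordan_inside_outside[OF sp loop]
  let ?I = "inside (path_image (h +++ d))" and ?O = "outside (path_image (h +++ d))"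
  have con: "connected ?I" "connected ?O" and IO: "?I \<union> ?O = - path_image (h +++ d)" using jordan by auto
  have pair: "connected_component (?B - g ` {a..b}) x y"
    if xy: "x \<in> ball (g u) \<epsilon>" "y \<in> ball (g u) \<epsilon>" and same: "connected_component (- path_image (h +++ d)) x y" for x y
  proof -
    have "connected_component (- R) x y"
      unfolding connected_component_def using \<epsilon>(2) xy by (intro exI[of _ "ball (g u) \<epsilon>"]) auto
    then have "connected_component (- (path_image (h +++ d) \<union> R)) x y"
      \<comment> \<open>The points are joined off \<open>R\<close> inside the small ball and joined
        off the curve by assumption. The two obstacles meet in the connected set
        \<open>path_image d\<close>, so the points are joined off their union.\<close>
      by (intro Janiszewski[OF _ \<open>closed R\<close> _ same])
        (use int sp d in \<open>auto simp: compact_simple_path_image connected_arc_image\<close>)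
    then show ?thesis by (rule connected_component_of_subset[OF _ whole])
  qed
  have Iside: "connected_component (- path_image (h +++ d)) x y" if "x \<in> ?I" "y \<in> ?I" for x y
    unfolding connected_component_def using con(1) IO that by (intro exI[of _ ?I]) blast
  have Oside: "connected_component (- path_image (h +++ d)) x y" if "x \<in> ?O" "y \<in> ?O" for x y
    unfolding connected_component_def using con(2) IO that by (intro exI[of _ ?O]) blast
  have \<epsilon>B: "ball (g u) \<epsilon> \<subseteq> ?B" using \<epsilon>(2) unfolding R_def by blast
  show thesis
  proof (rule that[of "min \<epsilon> r"])
    show "0 < min \<epsilon> r" "min \<epsilon> r \<le> r" using \<epsilon>(1) r by auto
    fix x y z assume xyz: "{x, y, z} \<subseteq> ball (g u) (min \<epsilon> r) - g ` {a..b}"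
    then have b: "x \<in> ball (g u) \<epsilon>" "y \<in> ball (g u) \<epsilon>" "z \<in> ball (g u) \<epsilon>" by auto
    have "w \<in> ?I \<union> ?O" if w: "w \<in> ball (g u) \<epsilon>" "w \<notin> g ` {a..b}" for w
    proof -
      have "w \<notin> sphere (g u) r" using w(1) \<epsilon>B by auto
      moreover have "g ` {s..t} \<subseteq> g ` {a..b}" using su tu by (intro image_mono) auto
      ultimately have "w \<notin> path_image (h +++ d)" unfolding J using w(2) d(2) by blast
      then show ?thesis unfolding IO by simp
    qed
    from this[OF b(1)] this[OF b(2)] this[OF b(3)]
    have side: "x \<in> ?I \<or> x \<in> ?O" "y \<in> ?I \<or> y \<in> ?O" "z \<in> ?I \<or> z \<in> ?O" using xyz by blast+
    show "connected_component (?B - g ` {a..b}) x y \<or> connected_component (?B - g ` {a..b}) y z \<or>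
      connected_component (?B - g ` {a..b}) x z"
      using side Iside Oside pair b by metis
  qed
qed

text \<open>The chart takes values in \<open>complex\<close> to fit \<open>planar_two_sides\<close>.
  Its image is the whole plane, so the inverse \<open>g\<close> is total, and images of arbitrary
  open or connected plane sets can be used directly.\<close>

lemma surface_chart:
  assumes X: "closed_surface X" and x: "x \<in> topspace X"
  obtains U f and g :: "complex \<Rightarrow> 'a" where "openin X U" "x \<in> U"
    "continuous_map (subtopology X U) euclidean f" "continuous_map euclidean X g"
    "\<And>y. y \<in> U \<Longrightarrow> g (f y) = y" "\<And>z. f (g z) = z" "\<And>z. g z \<in> U"
    "\<And>S. open S \<Longrightarrow> openin X (g ` S)" "\<And>S. connected S \<Longrightarrow> connectedin X (g ` S)"
proof -
  obtain U where U: "openin X U" "x \<in> U"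
    and hom: "subtopology X U homeomorphic_space (euclidean :: (real^2) topology)"
    using X x unfolding closed_surface_def by blast
  have "(UNIV :: (real^2) set) homeomorphic (UNIV :: complex set)"
    by (rule homeomorphic_subspaces) (auto simp: dim_UNIV)
  then have "(euclidean :: (real^2) topology) homeomorphic_space (euclidean :: complex topology)"
    unfolding homeomorphic_space_def homeomorphic_maps_def homeomorphic_def homeomorphism_def
    by (metis UNIV_I continuous_map_iff_continuous2)
  then have "subtopology X U homeomorphic_space (euclidean :: complex topology)"
    using hom homeomorphic_space_trans by blast
  then obtain f g where fg: "homeomorphic_maps (subtopology X U) (euclidean :: complex topology) f g"
    unfolding homeomorphic_space_def by blast
  have US: "topspace (subtopology X U) = U" using U(1) openin_subset by (auto simp: topspace_subtopology)
  have gc: "continuous_map euclidean (subtopology X U) g" and fc: "continuous_map (subtopology X U) euclidean f"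
    and gf: "\<And>y. y \<in> U \<Longrightarrow> g (f y) = y" and fg': "\<And>z. f (g z) = z"
    using fg US unfolding homeomorphic_maps_def by auto
  have gU: "g z \<in> U" for z using gc US continuous_map_image_subset_topspace by fastforce
  have gX: "continuous_map euclidean X g" using gc continuous_map_into_fulltopology by blast
  show thesis
  proof (rule that[OF U fc gX gf fg' gU])
    fix S :: "complex set" assume "open S"
    have "g ` S = {y \<in> topspace (subtopology X U). f y \<in> S}" 
    proof (intro equalityI subsetI)
      fix y assume "y \<in> g ` S"
      then show "y \<in> {y \<in> topspace (subtopology X U). f y \<in> S}" using gU fg' US by auto
    next
      fix y assume y: "y \<in> {y \<in> topspace (subtopology X U). f y \<in> S}"
      then have "y = g (f y)" using gf US by simp
      then show "y \<in> g ` S" using y by blast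
    qed
    moreover have "openin (subtopology X U) {y \<in> topspace (subtopology X U). f y \<in> S}"
      by (rule openin_continuous_map_preimage[OF fc]) (simp add: \<open>open S\<close>)
    ultimately show "openin X (g ` S)" using U(1) by (simp add: openin_open_subtopology)
  next
    fix S :: "complex set" assume "connected S"
    then show "connectedin X (g ` S)" by (intro connectedin_continuous_map_image[OF gX]) simp
  qed
qed

lemma closedin_path_image:
  assumes "Hausdorff_space X" "pathin X h" "0 \<le> a" "b \<le> 1"
  shows "closedin X (h ` {a..b})"
proof (rule compactin_imp_closedin[OF assms(1)])
  show "compactin X (h ` {a..b})"
  proof (rule image_compactin)
    show "compactin (top_of_set {0..1}) {a..b}" using assms by (auto simp: compactin_subtopology)
    show "continuous_map (top_of_set {0..1}) X h" using assms(2) unfolding pathin_def .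
  qed
qed

section \<open>Embedded graphs and the two sides of an edge\<close>

locale embedded_graph =
  fixes X :: "'a topology" and G :: "'v ugraph" and p :: "'v \<Rightarrow> 'a" and \<gamma> :: "'v set \<Rightarrow> real \<Rightarrow> 'a"
  assumes surface: "closed_surface X" and simple: "finite_simple_graph G" and emb: "embedded_in X G p \<gamma>"
begin

lemma Hausdorff: "Hausdorff_space X" and connected_X: "connected_space X"
  using surface unfolding closed_surface_def by simp_all

lemma edge_path:
  assumes "e \<in> gedges G"
  shows "pathin X (\<gamma> e)" "inj_on (\<gamma> e) {0..1}" "{\<gamma> e 0, \<gamma> e 1} = p ` e"
    "\<gamma> e ` {0<..<1} \<inter> p ` gverts G = {}"
  using assms emb unfolding embedded_in_def by simp_all

lemma edge_interiors_disjoint: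
  assumes "e \<in> gedges G" "e' \<in> gedges G" "e \<noteq> e'"
  shows "\<gamma> e ` {0<..<1} \<inter> \<gamma> e' ` {0<..<1} = {}"
  using assms emb unfolding embedded_in_def by simp

lemma p_inj: "inj_on p (gverts G)" and p_in: "v \<in> gverts G \<Longrightarrow> p v \<in> topspace X"
  using emb unfolding embedded_in_def by blast+

lemma finite_verts: "finite (gverts G)" and edge_verts: "e \<in> gedges G \<Longrightarrow> e \<subseteq> gverts G"
  and edge_card: "e \<in> gedges G \<Longrightarrow> card e = 2"
  using simple unfolding finite_simple_graph_def by auto

lemma finite_edges: "finite (gedges G)"
  by (rule finite_subset[of _ "Pow (gverts G)"]) (use edge_verts finite_verts in auto)

lemma edge_ends: "e \<in> gedges G \<Longrightarrow> \<gamma> e 0 \<in> p ` gverts G \<and> \<gamma> e 1 \<in> p ` gverts G"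
proof -
  assume e: "e \<in> gedges G"
  have "{\<gamma> e 0, \<gamma> e 1} \<subseteq> p ` gverts G" unfolding edge_path(3)[OF e] by (rule image_mono[OF edge_verts[OF e]])
  then show ?thesis by simp
qed

lemma unit_interval: "{0..1::real} = {0<..<1} \<union> {0, 1}" by auto

lemma edge_image: "\<gamma> e ` {0..1} = \<gamma> e ` {0<..<1} \<union> {\<gamma> e 0, \<gamma> e 1}"
  unfolding unit_interval by (simp add: image_Un)

lemma interior_not_on_other_edge:
  assumes "e \<in> gedges G" "e' \<in> gedges G" "e \<noteq> e'"
  shows "\<gamma> e ` {0<..<1} \<inter> \<gamma> e' ` {0..1} = {}"
proof -
  have "{\<gamma> e' 0, \<gamma> e' 1} \<subseteq> p ` gverts G" using edge_ends[OF assms(2)] by simp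
  then have "\<gamma> e ` {0<..<1} \<inter> {\<gamma> e' 0, \<gamma> e' 1} = {}" using edge_path(4)[OF assms(1)] by blast
  then show ?thesis unfolding edge_image Int_Un_distrib using edge_interiors_disjoint[OF assms] by simp
qed

lemma closedin_point: "v \<in> gverts G \<Longrightarrow> closedin X {p v}"
  using Hausdorff p_in by (simp add: closedin_Hausdorff_singleton)

lemma closedin_points: "A \<subseteq> gverts G \<Longrightarrow> closedin X (p ` A)"
proof -
  assume A: "A \<subseteq> gverts G"
  have "closedin X (\<Union>((\<lambda>v. {p v}) ` A))"
  proof (rule closedin_Union)
    show "finite ((\<lambda>v. {p v}) ` A)" using finite_subset[OF A finite_verts] by simp
    fix T assume "T \<in> (\<lambda>v. {p v}) ` A"
    then show "closedin X T" using A closedin_point by blast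
  qed
  then show ?thesis by (simp add: UNION_singleton_eq_range)
qed

lemma closedin_edges: "A \<subseteq> gedges G \<Longrightarrow> closedin X (\<Union>e\<in>A. \<gamma> e ` {0..1})"
proof (rule closedin_Union)
  assume A: "A \<subseteq> gedges G"
  show "finite ((\<lambda>e. \<gamma> e ` {0..1}) ` A)" using finite_subset[OF A finite_edges] by simp
  fix T assume "T \<in> (\<lambda>e. \<gamma> e ` {0..1}) ` A"
  then obtain e where "e \<in> gedges G" "T = \<gamma> e ` {0..1}" using A by blast
  then show "closedin X T" using closedin_path_image[OF Hausdorff edge_path(1)] by simp
qed

lemma drawing_mono: "subgraph_of H G \<Longrightarrow> drawing p \<gamma> H \<subseteq> drawing p \<gamma> G"
  unfolding subgraph_of_def drawing_def by (intro Un_mono image_mono UN_mono) auto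

lemma closedin_drawing: "subgraph_of H G \<Longrightarrow> closedin X (drawing p \<gamma> H)"
  unfolding drawing_def subgraph_of_def using closedin_points closedin_edges by (intro closedin_Un) auto

lemma subgraph_refl: "subgraph_of G G"
  unfolding subgraph_of_def using edge_verts by blast

abbreviation "Dr \<equiv> drawing p \<gamma> G"
abbreviation "regions \<equiv> open_regions X G p \<gamma>"

lemma openin_complement: "openin X (topspace X - Dr)"
  by (intro openin_diff openin_topspace closedin_drawing subgraph_refl)

text \<open>A chart carries \<open>planar_two_sides\<close> to the surface: near an inner point of
  an edge the drawing is only a piece of that edge, so among three nearby points two are joined off
  the drawing. The \<open>A i\<close> are arbitrary sets off the edge rather than regions, because
  one of them will be the complement of a union of closed regions.\<close>

lemma edge_two_sides:
  assumes e: "e \<in> gedges G" and u: "0 < u" "u < 1"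
    and A: "\<And>i. i \<in> {1, 2, 3::nat} \<Longrightarrow> \<gamma> e u \<in> X closure_of (A i)"
    and off: "\<And>i. i \<in> {1, 2, 3::nat} \<Longrightarrow> A i \<inter> \<gamma> e ` {0..1} = {}"
  obtains T i j where "connectedin X T" "T \<inter> Dr = {}" "i \<in> {1, 2, 3::nat}" "j \<in> {1, 2, 3::nat}" "i \<noteq> j"
    "T \<inter> A i \<noteq> {}" "T \<inter> A j \<noteq> {}"
proof -
  note result = that
  let ?y = "\<gamma> e u"
  note ep = edge_path[OF e]
  have yX: "?y \<in> topspace X" using A[of 1] by (simp add: in_closure_of)
  obtain U f and g :: "complex \<Rightarrow> 'a" where U: "openin X U" "?y \<in> U"
    and fc: "continuous_map (subtopology X U) euclidean f" and gc: "continuous_map euclidean X g"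
    and gf: "\<And>y. y \<in> U \<Longrightarrow> g (f y) = y" and fg: "\<And>z. f (g z) = z" and gU: "\<And>z. g z \<in> U"
    and gopen: "\<And>S. open S \<Longrightarrow> openin X (g ` S)" and gconn: "\<And>S. connected S \<Longrightarrow> connectedin X (g ` S)"
    using surface_chart[OF surface yX] by metis
  have contin: "continuous_map (top_of_set {0..1}) X (\<gamma> e)" using ep(1) unfolding pathin_def .
  have "openin (top_of_set {0..1}) {t \<in> topspace (top_of_set {0..1}). \<gamma> e t \<in> U}"
    by (rule openin_continuous_map_preimage[OF contin U(1)])
  then obtain T where T: "open T" "{t \<in> topspace (top_of_set {0..1}). \<gamma> e t \<in> U} = {0..1} \<inter> T"
    unfolding openin_open by auto
  have "u \<in> {0..1} \<inter> T" unfolding T(2)[symmetric] using u U(2) by simp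
  then have "u \<in> T \<inter> {0<..<1}" using u by simp
  moreover have "open (T \<inter> {0<..<1})" using T(1) by (intro open_Int open_greaterThanLessThan)
  \<comment> \<open>The piece of the edge for parameters within \<open>d\<close> of \<open>u\<close>
    stays in the chart and away from the ends of the edge.\<close>
  ultimately obtain d where d: "0 < d" "cball u d \<subseteq> T \<inter> {0<..<1}" unfolding open_contains_cball by blast
  define a where "a = u - d"
  define b where "b = u + d"
  have ab: "{a..b} \<subseteq> T \<inter> {0<..<1}" "a < u" "u < b" using d unfolding a_def b_def cball_eq_atLeastAtMost by auto
  have "a \<in> {a..b}" "b \<in> {a..b}" using ab(2,3) by auto
  then have "a \<in> {0<..<1}" "b \<in> {0<..<1}" using ab(1) by blast+
  then have ab01: "0 < a" "b < 1" by auto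
  have abU: "\<gamma> e t \<in> U" if "t \<in> {a..b}" for t
  proof -
    have "t \<in> {0..1} \<inter> T" using ab that by auto
    then show ?thesis unfolding T(2)[symmetric] by simp
  qed
  define h where "h = f \<circ> \<gamma> e"
  have gh: "g (h t) = \<gamma> e t" if "t \<in> {a..b}" for t unfolding h_def using gf abU[OF that] by simp
  have hcont: "continuous_on {a..b} h"
  proof -
    have "continuous_map (top_of_set {a..b}) X (\<gamma> e)"
      by (rule continuous_map_from_subtopology_mono[OF contin]) (use ab01 in auto)
    then have "continuous_map (top_of_set {a..b}) (subtopology X U) (\<gamma> e)"
      unfolding continuous_map_in_subtopology using abU by auto
    then have "continuous_map (top_of_set {a..b}) euclidean h" unfolding h_def
      by (rule continuous_map_compose[OF _ fc])
    then show ?thesis by simp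
  qed
  have hinj: "inj_on h {a..b}"
  proof (rule inj_onI)
    fix s t assume st: "s \<in> {a..b}" "t \<in> {a..b}" "h s = h t"
    then have "\<gamma> e s = \<gamma> e t" using gh by metis
    moreover have "s \<in> {0..1}" "t \<in> {0..1}" using st ab01 by auto
    ultimately show "s = t" using inj_onD[OF ep(2)] by blast
  qed
  \<comment> \<open>The rest of the drawing. It is closed and misses \<open>\<gamma> e u\<close>, so
    a disc around \<open>h u\<close> avoids it and sees only the chosen piece of the edge.\<close>
  define R where "R = p ` gverts G \<union> (\<Union>e'\<in>gedges G - {e}. \<gamma> e' ` {0..1}) \<union> \<gamma> e ` {0..a} \<union> \<gamma> e ` {b..1}"
  have Rclosed: "closedin X R" unfolding R_def
    by (intro closedin_Un closedin_points closedin_edges closedin_path_image[OF Hausdorff ep(1)]) (use ab01 ab in auto)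
  have Rout: "\<gamma> e t \<notin> R" if t: "a < t" "t < b" for t
  proof
    assume "\<gamma> e t \<in> R"
    have t01: "t \<in> {0<..<1}" using t ab01 by auto
    have "\<gamma> e t \<notin> p ` gverts G" using ep(4) t01 by blast
    moreover have "\<gamma> e t \<notin> \<gamma> e' ` {0..1}" if "e' \<in> gedges G - {e}" for e'
      using interior_not_on_other_edge[OF e, of e'] that t01 by blast
    ultimately have "\<gamma> e t \<in> \<gamma> e ` ({0..a} \<union> {b..1})" using \<open>\<gamma> e t \<in> R\<close> unfolding R_def by blast
    then obtain t' where t': "t' \<in> {0..a} \<union> {b..1}" "\<gamma> e t = \<gamma> e t'" by blast
    then have "t' \<in> {0..1}" "t \<in> {0..1}" using t01 ab01 ab by auto
    then have "t = t'" using inj_onD[OF ep(2)] t' by blast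
    then show False using t t' by auto
  qed
  have cover: "Dr \<subseteq> R \<union> \<gamma> e ` {a..b}"
  proof -
    have "{0..1} \<subseteq> {0..a} \<union> {a..b} \<union> {b..1}" by auto
    then have "\<gamma> e ` {0..1} \<subseteq> \<gamma> e ` {0..a} \<union> \<gamma> e ` {a..b} \<union> \<gamma> e ` {b..1}" by blast
    moreover have "(\<Union>e'\<in>gedges G. \<gamma> e' ` {0..1}) = (\<Union>e'\<in>gedges G - {e}. \<gamma> e' ` {0..1}) \<union> \<gamma> e ` {0..1}"
      using e by auto
    ultimately show ?thesis unfolding drawing_def R_def by auto
  qed
  have "openin euclidean {z \<in> topspace euclidean. g z \<in> topspace X - R}"
    by (rule openin_continuous_map_preimage[OF gc]) (use Rclosed in auto)
  then have opN: "open {z. g z \<in> topspace X - R}" by simp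
  have hu: "g (h u) = ?y" using gh ab by simp
  then have "h u \<in> {z. g z \<in> topspace X - R}" using Rout[of u] ab yX by simp
  then obtain r where r: "0 < r" "ball (h u) r \<subseteq> {z. g z \<in> topspace X - R}"
    using opN unfolding open_contains_ball by blast
  \<comment> \<open>The ends of the piece are deliberately kept in \<open>R\<close>: this places
    them outside the disc, as \<open>planar_two_sides\<close> requires.\<close>
  have "\<gamma> e a \<in> R" "\<gamma> e b \<in> R" unfolding R_def using ab01 by auto
  then have "g (h a) \<in> R" "g (h b) \<in> R" using gh ab by auto
  then have ends: "h a \<notin> ball (h u) r" "h b \<notin> ball (h u) r" using r(2) by blast+
  obtain \<epsilon> where \<epsilon>: "0 < \<epsilon>" "\<epsilon> \<le> r"
    and sides: "\<And>x y z. {x, y, z} \<subseteq> ball (h u) \<epsilon> - h ` {a..b} \<Longrightarrow>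
      connected_component (ball (h u) r - h ` {a..b}) x y \<or>
      connected_component (ball (h u) r - h ` {a..b}) y z \<or>
      connected_component (ball (h u) r - h ` {a..b}) x z"
    using planar_two_sides[OF hcont hinj ab(2,3) r(1) ends] by metis
  have "openin X (g ` ball (h u) \<epsilon>)" by (rule gopen) simp
  moreover have "?y \<in> g ` ball (h u) \<epsilon>" using hu \<epsilon>(1) by (metis centre_in_ball imageI)
  ultimately have "\<exists>x\<in>A i. x \<in> g ` ball (h u) \<epsilon>" if "i \<in> {1, 2, 3}" for i
    using A[OF that] unfolding in_closure_of by blast
  then have pt: "\<exists>z. z \<in> ball (h u) \<epsilon> \<and> g z \<in> A i" if "i \<in> {1, 2, 3}" for i using that by blast
  have "\<exists>z. z \<in> ball (h u) \<epsilon> - h ` {a..b} \<and> g z \<in> A i" if i: "i \<in> {1, 2, 3}" for i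
  proof -
    obtain z where z: "z \<in> ball (h u) \<epsilon>" "g z \<in> A i" using pt[OF i] by blast
    have "z \<notin> h ` {a..b}"
    proof
      assume "z \<in> h ` {a..b}"
      then obtain t where t: "t \<in> {a..b}" "z = h t" by blast
      then have "g z = \<gamma> e t" "t \<in> {0..1}" using gh ab01 by auto
      then have "g z \<in> \<gamma> e ` {0..1}" by blast
      then show False using off[OF i] z by blast
    qed
    then show ?thesis using z by blast
  qed
  then have "\<forall>i\<in>{1, 2, 3}. \<exists>z. z \<in> ball (h u) \<epsilon> - h ` {a..b} \<and> g z \<in> A i" by blast
  from bchoice[OF this] obtain z
    where z0: "\<forall>i\<in>{1, 2, 3}. z i \<in> ball (h u) \<epsilon> - h ` {a..b} \<and> g (z i) \<in> A i" by (rule exE)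
  have z: "z i \<in> ball (h u) \<epsilon> - h ` {a..b}" "g (z i) \<in> A i" if "i \<in> {1, 2, 3}" for i
    using bspec[OF z0 that] by (rule conjunct1, rule conjunct2)
  have fin: thesis if ij: "i \<in> {1, 2, 3}" "j \<in> {1, 2, 3}" "i \<noteq> j"
    and cc: "connected_component (ball (h u) r - h ` {a..b}) (z i) (z j)" for i j
  proof -
    obtain T where T: "connected T" "T \<subseteq> ball (h u) r - h ` {a..b}" "z i \<in> T" "z j \<in> T"
      using cc unfolding connected_component_def by blast
    have "g w \<notin> Dr" if w: "w \<in> T" for w
    proof
      assume "g w \<in> Dr"
      moreover have "g w \<notin> R" using w T(2) r(2) by blast
      ultimately obtain t where t: "t \<in> {a..b}" "g w = \<gamma> e t" using cover by blast
      then have "w = h t" using fg gh by metis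
      then show False using w T(2) t by blast
    qed
    then have "g ` T \<inter> Dr = {}" by blast
    moreover have "g ` T \<inter> A i \<noteq> {}" "g ` T \<inter> A j \<noteq> {}" using T(3,4) z(2)[OF ij(1)] z(2)[OF ij(2)] by blast+
    ultimately show thesis using result[OF gconn[OF T(1)] _ ij] by simp
  qed
  have "{z 1, z 2, z 3} \<subseteq> ball (h u) \<epsilon> - h ` {a..b}" using z(1)[of 1] z(1)[of 2] z(1)[of 3] by simp
  from sides[OF this] show thesis
  proof (elim disjE)
    show thesis if "connected_component (ball (h u) r - h ` {a..b}) (z 1) (z 2)" by (rule fin[OF _ _ _ that]) auto
    show thesis if "connected_component (ball (h u) r - h ` {a..b}) (z 2) (z 3)" by (rule fin[OF _ _ _ that]) auto
    show thesis if "connected_component (ball (h u) r - h ` {a..b}) (z 1) (z 3)" by (rule fin[OF _ _ _ that]) auto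
  qed
qed

end

section \<open>Faces covering each of their edges twice\<close>

context embedded_graph
begin

text \<open>Connectedness of the punctured disc is special to dimension at least two. It will allow
  an argument stuck at a vertex to move off that vertex.\<close>

lemma small_disc:
  assumes N: "openin X N" "x \<in> N"
  obtains V where "openin X V" "x \<in> V" "V \<subseteq> N" "connectedin X V" "connectedin X (V - {x})"
proof -
  have xX: "x \<in> topspace X" using N openin_subset by blast
  obtain U f and g :: "complex \<Rightarrow> 'a" where U: "openin X U" "x \<in> U"
    and fc: "continuous_map (subtopology X U) euclidean f" and gc: "continuous_map euclidean X g"
    and gf: "\<And>y. y \<in> U \<Longrightarrow> g (f y) = y" and fg: "\<And>z. f (g z) = z" and gU: "\<And>z. g z \<in> U"
    and gopen: "\<And>S. open S \<Longrightarrow> openin X (g ` S)" and gconn: "\<And>S. connected S \<Longrightarrow> connectedin X (g ` S)"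
    using surface_chart[OF surface xX] by metis
  have "openin euclidean {z \<in> topspace euclidean. g z \<in> N}"
    by (rule openin_continuous_map_preimage[OF gc N(1)])
  then have "open {z. g z \<in> N}" by simp
  moreover have gx: "g (f x) = x" using gf U by blast
  then have "f x \<in> {z. g z \<in> N}" using N by simp
  ultimately obtain r where r: "0 < r" "ball (f x) r \<subseteq> {z. g z \<in> N}" unfolding open_contains_ball by blast
  have del: "g ` ball (f x) r - {x} = g ` (ball (f x) r - {f x})"
  proof -
    have "inj g" using fg by (metis injI)
    then show ?thesis by (simp add: image_set_diff gx)
  qed
  show thesis
  proof (rule that[of "g ` ball (f x) r"])
    show "openin X (g ` ball (f x) r)" by (rule gopen) simp
    show "x \<in> g ` ball (f x) r" using gx r(1) by (metis centre_in_ball imageI)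
    show "g ` ball (f x) r \<subseteq> N" using r(2) by blast
    show "connectedin X (g ` ball (f x) r)" by (rule gconn) simp
    show "connectedin X (g ` ball (f x) r - {x})" unfolding del
      by (intro gconn connected_punctured_ball) simp
  qed
qed

lemma region_subset: "c \<in> regions \<Longrightarrow> c \<subseteq> topspace X - Dr"
  unfolding open_regions_def using connected_components_of_subset by fastforce

lemma region_nonempty: "c \<in> regions \<Longrightarrow> c \<noteq> {}"
  unfolding open_regions_def by (rule nonempty_connected_components_of)

lemma region_maximal:
  assumes "c \<in> regions" "connectedin X T" "T \<inter> Dr = {}" "T \<inter> c \<noteq> {}"
  shows "T \<subseteq> c"
proof -
  have "T \<subseteq> topspace X - Dr" using assms(2,3) connectedin_subset_topspace by blast
  then have "connectedin (subtopology X (topspace X - Dr)) T" using assms(2) by (simp add: connectedin_subtopology)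
  moreover have "\<not> disjnt c T" using assms(4) unfolding disjnt_def by blast
  ultimately show ?thesis using connected_components_of_maximal assms(1) unfolding open_regions_def by blast
qed

lemma regions_disjoint: "c \<in> regions \<Longrightarrow> c' \<in> regions \<Longrightarrow> c \<inter> c' \<noteq> {} \<Longrightarrow> c = c'"
  unfolding open_regions_def using connected_components_of_overlap by blast

text \<open>Connected components are open here because the surface is locally connected: a small
  disc off the drawing lies in a single region.\<close>

lemma region_open:
  assumes c: "c \<in> regions"
  shows "openin X c"
proof (subst openin_subopen, intro ballI)
  fix x assume x: "x \<in> c"
  then have "x \<in> topspace X - Dr" using region_subset[OF c] by blast
  then obtain V where V: "openin X V" "x \<in> V" "V \<subseteq> topspace X - Dr" "connectedin X V"
    using small_disc[OF openin_complement] by metis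
  have "V \<subseteq> c" by (rule region_maximal[OF c V(4)]) (use V x in blast)+
  then show "\<exists>V. openin X V \<and> x \<in> V \<and> V \<subseteq> c" using V by blast
qed

text \<open>An open set meeting the closure of another set meets that set itself. Faces and open
  regions are thereby interchangeable.\<close>

lemma region_closure_inj:
  assumes "c \<in> regions" "c' \<in> regions" "X closure_of c = X closure_of c'"
  shows "c = c'"
proof (rule regions_disjoint[OF assms(1,2)])
  have "c \<subseteq> X closure_of c'" using closure_of_subset[of c X] region_subset[OF assms(1)] assms(3) by blast
  then have "c \<inter> X closure_of c' \<noteq> {}" using region_nonempty[OF assms(1)] by blast
  then show "c \<inter> c' \<noteq> {}" using openin_Int_closure_of_eq_empty[OF region_open[OF assms(1)]] by blast
qed

lemma region_closure:
  assumes c: "c \<in> regions"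
  shows "X closure_of c = c \<union> X frontier_of c"
  using interior_of_union_frontier_of[of X c] interior_of_openin[OF region_open[OF c]] by simp

lemma vertex_near_edge:
  assumes e: "e \<in> gedges G" and v: "v \<in> e" and V: "openin X V" "p v \<in> V"
  obtains t where "0 < t" "t < 1" "\<gamma> e t \<in> V"
proof -
  note ep = edge_path[OF e]
  have contin: "continuous_map (top_of_set {0..1}) X (\<gamma> e)" using ep(1) unfolding pathin_def .
  have "openin (top_of_set {0..1}) {t \<in> topspace (top_of_set {0..1}). \<gamma> e t \<in> V}"
    by (rule openin_continuous_map_preimage[OF contin V(1)])
  then obtain T where T: "open T" "{t \<in> topspace (top_of_set {0..1}). \<gamma> e t \<in> V} = {0..1} \<inter> T"
    unfolding openin_open by auto
  have inT: "\<gamma> e t \<in> V \<longleftrightarrow> t \<in> T" if "t \<in> {0..1}" for t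
  proof -
    have "t \<in> {t \<in> topspace (top_of_set {0..1}). \<gamma> e t \<in> V} \<longleftrightarrow> t \<in> {0..1} \<inter> T" unfolding T(2) ..
    then show ?thesis using that by simp
  qed
  have "p v \<in> {\<gamma> e 0, \<gamma> e 1}" unfolding ep(3) using v by blast
  then have "\<exists>t0\<in>{0, 1}. \<gamma> e t0 = p v" by auto
  then obtain t0 where t0: "t0 \<in> {0, 1}" "\<gamma> e t0 = p v" by blast
  then have "t0 \<in> T" using inT[of t0] V(2) by auto
  then obtain d where d: "0 < d" "ball t0 d \<subseteq> T" using T(1) unfolding open_contains_ball by blast
  \<comment> \<open>Half of \<open>d\<close> keeps the parameter in the ball, and the bound 1/2
    keeps it strictly between 0 and 1 from whichever end it is measured.\<close>
  define s where "s = min (d / 2) (1 / 2)"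
  define t where "t = (if t0 = 0 then s else 1 - s)"
  have s: "0 < s" "s < d" "s < 1" using d(1) unfolding s_def by auto
  have "0 < t" "t < 1" using s unfolding t_def by auto
  moreover have "t \<in> ball t0 d" using s t0(1) unfolding t_def by (auto simp: dist_real_def)
  ultimately show thesis using that[of t] inT[of t] d(2) by auto
qed

text \<open>
  If the closed regions in \<open>\<R>\<close> did not cover the surface, the complement \<open>B\<close> of their union
  would have a frontier point on one of the boundary cycles. A punctured disc around a vertex is
  connected, so such a point can be found in the interior of an edge; there \<open>B\<close> and two regions of
  \<open>\<R>\<close> would all accumulate.
\<close>

lemma regions_exhausted:
  assumes R: "\<R> \<subseteq> regions" "\<R> \<noteq> {}" "finite \<R>"
    and sub: "\<And>c. c \<in> \<R> \<Longrightarrow> subgraph_of (C c) G"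
    and verts: "\<And>c. c \<in> \<R> \<Longrightarrow> gverts (C c) = \<Union>(gedges (C c))"
    and bd: "\<And>c. c \<in> \<R> \<Longrightarrow> X frontier_of c = drawing p \<gamma> (C c)"
    and twice: "\<And>c e. c \<in> \<R> \<Longrightarrow> e \<in> gedges (C c) \<Longrightarrow> \<exists>c'\<in>\<R>. c' \<noteq> c \<and> e \<in> gedges (C c')"
  shows "\<R> = regions"
proof -
  let ?D = "\<lambda>c. drawing p \<gamma> (C c)"
  have reg: "c \<in> regions" if "c \<in> \<R>" for c using R(1) that by blast
  have cl: "X closure_of c = c \<union> ?D c" if "c \<in> \<R>" for c using region_closure[OF reg[OF that]] bd[OF that] by simp
  define U where "U = (\<Union>c\<in>\<R>. X closure_of c)"
  have Ucl: "closedin X U" unfolding U_def by (rule closedin_Union) (use R(3) in auto)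
  define B where "B = topspace X - U"
  have Bop: "openin X B" unfolding B_def using Ucl by (intro openin_diff openin_topspace)
  have cU: "c \<subseteq> U" "?D c \<subseteq> U" if "c \<in> \<R>" for c using cl[OF that] that unfolding U_def by blast+
  have BU: "B \<inter> U = {}" unfolding B_def by blast
  have edgeD: "\<gamma> e ` {0..1} \<subseteq> ?D c" if "e \<in> gedges (C c)" for c e using that unfolding drawing_def by blast
  have edgeG: "e \<in> gedges G" if "c \<in> \<R>" "e \<in> gedges (C c)" for c e
    using sub[OF that(1)] that(2) unfolding subgraph_of_def by blast
  have no_edge_point: False
    if c: "c \<in> \<R>" and e: "e \<in> gedges (C c)" and u: "0 < u" "u < 1" and yB: "\<gamma> e u \<in> X closure_of B" for c e u
  proof -
    obtain c' where c': "c' \<in> \<R>" "c' \<noteq> c" "e \<in> gedges (C c')" using twice[OF c e] by blast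
    define A where "A i = (if i = (1::nat) then c else if i = 2 then c' else B)" for i
    have u01: "u \<in> {0..1}" using u by simp
    have eG: "e \<in> gedges G" by (rule edgeG[OF c e])
    have eDr: "\<gamma> e ` {0..1} \<subseteq> Dr" using eG unfolding drawing_def by blast
    have y: "\<gamma> e u \<in> X closure_of c" "\<gamma> e u \<in> X closure_of c'"
      using edgeD[OF e] edgeD[OF c'(3)] cl[OF c] cl[OF c'(1)] u01 by blast+
    obtain T i j where T: "connectedin X T" "T \<inter> Dr = {}" and ij: "i \<in> {1, 2, 3::nat}" "j \<in> {1, 2, 3::nat}" "i \<noteq> j"
      and Ti: "T \<inter> A i \<noteq> {}" "T \<inter> A j \<noteq> {}"
    proof (rule edge_two_sides[OF eG u, of A])
      show "\<gamma> e u \<in> X closure_of A i" if "i \<in> {1, 2, 3}" for i using y yB unfolding A_def by simp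
      show "A i \<inter> \<gamma> e ` {0..1} = {}" if "i \<in> {1, 2, 3}" for i
      proof -
        have "c \<inter> \<gamma> e ` {0..1} = {}" "c' \<inter> \<gamma> e ` {0..1} = {}"
          using region_subset[OF reg[OF c]] region_subset[OF reg[OF c'(1)]] eDr by blast+
        moreover have "B \<inter> \<gamma> e ` {0..1} = {}" using edgeD[OF e] cU(2)[OF c] BU by blast
        ultimately show ?thesis unfolding A_def by simp
      qed
    qed
    \<comment> \<open>A connected set off the drawing that meets a region is contained in it, so
      \<open>T\<close> cannot meet two of the pairwise disjoint sets \<open>c\<close>,
      \<open>c'\<close> and \<open>B\<close>.\<close>
    have Tc: "T \<subseteq> d" if "d \<in> \<R>" "T \<inter> d \<noteq> {}" for d using region_maximal[OF reg[OF that(1)] T that(2)] .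
    have cc': "c \<inter> c' = {}" using regions_disjoint[OF reg[OF c] reg[OF c'(1)]] c'(2) by blast
    have x1: "\<not> (T \<inter> c \<noteq> {} \<and> T \<inter> c' \<noteq> {})" using Tc[OF c] cc' by blast
    have x2: "\<not> (T \<inter> c \<noteq> {} \<and> T \<inter> B \<noteq> {})" using Tc[OF c] cU(1)[OF c] BU by blast
    have x3: "\<not> (T \<inter> c' \<noteq> {} \<and> T \<inter> B \<noteq> {})" using Tc[OF c'(1)] cU(1)[OF c'(1)] BU by blast
    show False using x1 x2 x3 Ti ij unfolding A_def by (auto split: if_splits)
  qed
  have on_D: "\<exists>c\<in>\<R>. x \<in> ?D c" if x: "x \<in> X closure_of B" "x \<in> U" for x
  proof -
    obtain c where c: "c \<in> \<R>" "x \<in> c \<union> ?D c" using x(2) cl unfolding U_def by blast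
    have "c \<inter> B = {}" using cU(1)[OF c(1)] BU by blast
    then have "c \<inter> X closure_of B = {}" using openin_Int_closure_of_eq_empty[OF region_open[OF reg[OF c(1)]]] by blast
    then show ?thesis using c x(1) by blast
  qed
  have vertex: "\<exists>v\<in>gverts (C c). x = p v" if c: "c \<in> \<R>" and x: "x \<in> ?D c" "x \<in> X closure_of B" for c x
  proof (cases "x \<in> p ` gverts (C c)")
    case False
    then obtain e u where e: "e \<in> gedges (C c)" and u: "u \<in> {0..1}" "x = \<gamma> e u" using x(1) unfolding drawing_def by blast
    have ep: "{\<gamma> e 0, \<gamma> e 1} = p ` e" by (rule edge_path(3)[OF edgeG[OF c e]])
    have "p ` e \<subseteq> p ` gverts (C c)" using sub[OF c] e unfolding subgraph_of_def by blast
    then have "u \<noteq> 0" "u \<noteq> 1" using False u(2) unfolding ep[symmetric] by auto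
    then have "0 < u" "u < 1" using u(1) by auto
    then show ?thesis using no_edge_point[OF c e] x(2) u(2) by blast
  qed blast
  have no_meet: "X closure_of B \<inter> U = {}"
  proof (rule ccontr)
    assume "X closure_of B \<inter> U \<noteq> {}"
    then obtain x where x: "x \<in> X closure_of B" "x \<in> U" by blast
    obtain c where c: "c \<in> \<R>" "x \<in> ?D c" using on_D[OF x] by blast
    obtain v where v: "v \<in> gverts (C c)" "x = p v" using vertex[OF c x(1)] by blast
    then obtain e where e: "e \<in> gedges (C c)" "v \<in> e" using verts[OF c(1)] by blast
    have eG: "e \<in> gedges G" by (rule edgeG[OF c(1) e(1)])
    have vG: "v \<in> gverts G" using edge_verts[OF eG] e(2) by blast
    \<comment> \<open>The disc \<open>V\<close> is to contain no vertex but \<open>v\<close>: every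
      common point of \<open>U\<close> and the closure of \<open>B\<close> is a vertex, so a second
      one in \<open>V\<close> will be contradictory.\<close>
    have "openin X (topspace X - p ` (gverts G - {v}))"
      by (intro openin_diff openin_topspace closedin_points) blast
    moreover have "x \<in> topspace X - p ` (gverts G - {v})"
      using p_in[OF vG] p_inj vG v(2) by (auto dest: inj_onD)
    ultimately obtain V where V: "openin X V" "x \<in> V" "V \<subseteq> topspace X - p ` (gverts G - {v})"
      "connectedin X (V - {x})" using small_disc by metis
    have VB: "B \<inter> (V - {x}) \<noteq> {}"
    proof -
      have "\<exists>y. y \<in> B \<and> y \<in> V" using x(1) V(1,2) unfolding in_closure_of by blast
      moreover have "x \<notin> B" using x(2) BU by blast
      ultimately show ?thesis by blast
    qed
    obtain t where t: "0 < t" "t < 1" "\<gamma> e t \<in> V" using vertex_near_edge[OF eG e(2) V(1)] V(2) v(2) by metis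
    have "\<gamma> e t \<in> \<gamma> e ` {0<..<1}" "\<gamma> e t \<in> \<gamma> e ` {0..1}" using t by auto
    then have "\<gamma> e t \<noteq> x" "\<gamma> e t \<in> U"
      using edge_path(4)[OF eG] v(2) vG edgeD[OF e(1)] cU(2)[OF c(1)] by blast+
    then have VU: "\<gamma> e t \<in> (V - {x}) \<inter> U" using t by blast
    \<comment> \<open>The punctured disc meets \<open>B\<close>, and it meets \<open>U\<close> at a
      point of the edge \<open>e\<close>. Without such a \<open>y\<close> the open sets
      \<open>B\<close> and \<open>?E\<close> would disconnect it.\<close>
    have "\<exists>y. y \<in> V - {x} \<and> y \<in> X closure_of B \<and> y \<in> U"
    proof (rule ccontr)
      assume n: "\<not> (\<exists>y. y \<in> V - {x} \<and> y \<in> X closure_of B \<and> y \<in> U)"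
      have VX: "V \<subseteq> topspace X" using V(1) openin_subset by blast
      let ?E = "topspace X - X closure_of B"
      have "openin X ?E" by (intro openin_diff openin_topspace closedin_closure_of)
      moreover have "V - {x} \<subseteq> B \<union> ?E" using n VX unfolding B_def by blast
      moreover have "B \<inter> ?E = {}" using closure_of_subset[of B X] unfolding B_def by blast
      then have "B \<inter> ?E \<inter> (V - {x}) = {}" by blast
      moreover have "?E \<inter> (V - {x}) \<noteq> {}" using VU n VX by blast
      ultimately show False using V(4) VB Bop unfolding connectedin by blast
    qed
    then obtain y where y: "y \<in> V - {x}" "y \<in> X closure_of B" "y \<in> U" by blast
    obtain c' where c': "c' \<in> \<R>" "y \<in> ?D c'" using on_D[OF y(2,3)] by blast
    obtain w where w: "w \<in> gverts (C c')" "y = p w" using vertex[OF c' y(2)] by blast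
    have "w \<in> gverts G" using w(1) sub[OF c'(1)] unfolding subgraph_of_def by blast
    moreover have "w \<noteq> v" using y(1) w(2) v(2) by blast
    ultimately have "y \<in> p ` (gverts G - {v})" using w(2) by blast
    then show False using y(1) V(3) by blast
  qed
  have "closedin X B"
  proof -
    have "X closure_of B \<subseteq> B" using no_meet closure_of_subset_topspace[of X B] unfolding B_def by blast
    then show ?thesis using closure_of_subset_eq[of B X] unfolding B_def by blast
  qed
  then have "B = {} \<or> B = topspace X" using Bop connected_X unfolding connected_space_clopen_in by blast
  moreover obtain c0 where c0: "c0 \<in> \<R>" using R(2) by blast
  have "c0 \<subseteq> topspace X" "c0 \<noteq> {}" using region_subset[OF reg[OF c0]] region_nonempty[OF reg[OF c0]] by blast+
  then have "B \<noteq> topspace X" using cU(1)[OF c0] BU by blast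
  ultimately have UX: "topspace X \<subseteq> U" unfolding B_def by blast
  \<comment> \<open>A point of \<open>c\<close> lies in some closed region of \<R>; being off the
    drawing, it lies in the open region, which must then be \<open>c\<close>.\<close>
  have "c \<in> \<R>" if c: "c \<in> regions" for c
  proof -
    obtain x where x: "x \<in> c" using region_nonempty[OF c] by blast
    then have xX: "x \<in> topspace X" "x \<notin> Dr" using region_subset[OF c] by blast+
    then obtain c' where c': "c' \<in> \<R>" "x \<in> c' \<union> ?D c'" using UX cl unfolding U_def by blast
    then have "x \<in> c'" using drawing_mono[OF sub[OF c'(1)]] xX by blast
    then show ?thesis using regions_disjoint[OF c reg[OF c'(1)]] x c'(1) by blast
  qed
  then show ?thesis using R(1) by blast
qed

end

section \<open>Resonance graphs of even faces\<close>

context embedded_graph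
begin

abbreviation "fbd \<equiv> face_boundary X G p \<gamma>"
abbreviation "bE \<equiv> boundary_edges X G p \<gamma>"
abbreviation "even_f \<equiv> even_face X G p \<gamma>"
abbreviation "bcycle \<equiv> is_boundary_cycle X G p \<gamma>"

lemma face_boundary_closure: "c \<in> regions \<Longrightarrow> fbd (X closure_of c) = X frontier_of c"
proof -
  assume c: "c \<in> regions"
  have "{X frontier_of c' | c'. c' \<in> regions \<and> X closure_of c' = X closure_of c} = {X frontier_of c}"
    using region_closure_inj[OF _ c] c by blast
  then show ?thesis unfolding face_boundary_def by simp
qed

text \<open>An edge drawn inside a cycle \<open>C\<close> belongs to \<open>C\<close>, since its
  midpoint is neither a vertex nor a point of another edge. Hence the edge set defined by point sets
  agrees with the combinatorial one.\<close>

lemma boundary_edges_cycle: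
  assumes "bcycle C f"
  shows "bE f = gedges C"
proof -
  have C: "gverts C \<subseteq> gverts G" "gedges C \<subseteq> gedges G" "drawing p \<gamma> C = fbd f"
    using assms unfolding is_boundary_cycle_def subgraph_of_def by auto
  show ?thesis
  proof
    show "gedges C \<subseteq> bE f" unfolding boundary_edges_def C(3)[symmetric] drawing_def using C(2) by blast
    show "bE f \<subseteq> gedges C"
    proof (rule subsetI, rule ccontr)
      fix e assume e: "e \<in> bE f" and n: "e \<notin> gedges C"
      then have eG: "e \<in> gedges G" and sub: "\<gamma> e ` {0..1} \<subseteq> drawing p \<gamma> C"
        unfolding boundary_edges_def C(3) by auto
      have "(1/2 :: real) \<in> {0..1}" "(1/2 :: real) \<in> {0<..<1}" by auto
      then have m: "\<gamma> e (1/2) \<in> \<gamma> e ` {0<..<1}" "\<gamma> e (1/2) \<in> drawing p \<gamma> C" using sub by blast+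
      have "\<gamma> e (1/2) \<notin> p ` gverts C" using edge_path(4)[OF eG] m(1) C(1) by blast
      then obtain e' where e': "e' \<in> gedges C" "\<gamma> e (1/2) \<in> \<gamma> e' ` {0..1}" using m(2) unfolding drawing_def by blast
      then have "e' \<in> gedges G" "e \<noteq> e'" using C(2) n by blast+
      then show False using interior_not_on_other_edge[OF eG] m(1) e'(2) by blast
    qed
  qed
qed

text \<open>Every boundary cycle of \<open>f\<close> has the edge set \<open>bE f\<close>, which
  depends on \<open>f\<close> alone. The cycle is therefore unique, and the evenness of one witness
  holds for any other.\<close>

lemma even_face_circuit:
  assumes f: "even_f f"
  shows "circuit (bE f)" "bcycle C f \<longleftrightarrow> C = (\<Union>(bE f), bE f)"
proof -
  obtain C0 where C0: "bcycle C0 f" "even (card (gedges C0))" using f unfolding even_face_def by blast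
  have ev: "even (card (bE f))" using boundary_edges_cycle[OF C0(1)] C0(2) by simp
  have props: "circuit (bE f) \<and> C = (\<Union>(bE f), bE f)" if C: "bcycle C f" for C
  proof -
    have g: "gedges C = bE f" using boundary_edges_cycle[OF C] by simp
    have cy: "is_cycle C" using C unfolding is_boundary_cycle_def by blast
    have "even (card (gedges C))" using ev g by simp
    from cycle_edges_circuit[OF cy this] show ?thesis unfolding g by (metis g prod.collapse)
  qed
  show "circuit (bE f)" using props[OF C0(1)] by blast
  show "bcycle C f \<longleftrightarrow> C = (\<Union>(bE f), bE f)" using props C0(1) by blast
qed

lemma boundary_edges_subset: "bE f \<subseteq> gedges G"
  unfolding boundary_edges_def by blast

text \<open>Carries \<open>regions_exhausted\<close> over to faces, pairing each region with the
  unique boundary cycle of its closure.\<close>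

lemma faces_exhausted:
  assumes A: "finite A" "A \<noteq> {}" and ev: "\<And>f. f \<in> A \<Longrightarrow> even_f f"
    and twice: "\<And>f e. f \<in> A \<Longrightarrow> e \<in> bE f \<Longrightarrow> \<exists>f'\<in>A. f' \<noteq> f \<and> e \<in> bE f'"
  shows "A = faces X G p \<gamma>"
proof -
  have Af: "A \<subseteq> faces X G p \<gamma>" using ev unfolding even_face_def by blast
  define \<R> where "\<R> = {c \<in> regions. X closure_of c \<in> A}"
  define C where "C c = (\<Union>(bE (X closure_of c)), bE (X closure_of c))" for c
  have im: "(\<lambda>c. X closure_of c) ` \<R> = A" using Af unfolding \<R>_def faces_def by blast
  have bc: "bcycle (C c) (X closure_of c)" if "c \<in> \<R>" for c
    using even_face_circuit(2)[OF ev] that unfolding \<R>_def C_def by blast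
  have "\<R> = regions"
  proof (rule regions_exhausted)
    show "\<R> \<subseteq> regions" unfolding \<R>_def by blast
    show "\<R> \<noteq> {}" using im A(2) by blast
    have "inj_on (\<lambda>c. X closure_of c) \<R>" unfolding \<R>_def using region_closure_inj by (auto intro!: inj_onI)
    then show "finite \<R>" using finite_imageD im A(1) by metis
    show "subgraph_of (C c) G" if "c \<in> \<R>" for c using bc[OF that] unfolding is_boundary_cycle_def by blast
    show "gverts (C c) = \<Union>(gedges (C c))" for c unfolding C_def by simp
    show "X frontier_of c = drawing p \<gamma> (C c)" if "c \<in> \<R>" for c
      using bc[OF that] face_boundary_closure[of c] that unfolding is_boundary_cycle_def \<R>_def by simp
    show "\<exists>c'\<in>\<R>. c' \<noteq> c \<and> e \<in> gedges (C c')" if c: "c \<in> \<R>" and e: "e \<in> gedges (C c)" for c e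
    proof -
      have "X closure_of c \<in> A" "e \<in> bE (X closure_of c)" using c e unfolding \<R>_def C_def by auto
      then obtain f' where f': "f' \<in> A" "f' \<noteq> X closure_of c" "e \<in> bE f'" using twice by blast
      then obtain c' where "c' \<in> \<R>" "f' = X closure_of c'" using im by blast
      then show ?thesis using f' unfolding C_def by auto
    qed
  qed
  then show ?thesis using im unfolding faces_def by simp
qed

lemma resonant_graph_faces:
  assumes ev: "\<And>f. f \<in> F \<Longrightarrow> even_f f" and ne: "F \<noteq> faces X G p \<gamma>"
  shows "resonant_graph G (bE ` F)"
proof
  show "finite_simple_graph G" by (rule simple)
  show "circuit C" if "C \<in> bE ` F" for C using that even_face_circuit(1)[OF ev] by blast
  show "C \<subseteq> gedges G" if "C \<in> bE ` F" for C using that boundary_edges_subset by blast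
  fix C1 C2 C3 C4 assume C: "C1 \<in> bE ` F" "C2 \<in> bE ` F" "C3 \<in> bE ` F" "C4 \<in> bE ` F"
    and dist: "distinct [C1, C2, C3, C4]" and eq: "sym_diff C1 C2 = sym_diff C3 C4"
  obtain f1 f2 f3 f4 where f: "f1 \<in> F" "f2 \<in> F" "f3 \<in> F" "f4 \<in> F"
    and Cf: "C1 = bE f1" "C2 = bE f2" "C3 = bE f3" "C4 = bE f4" using C by blast
  have fd: "f1 \<noteq> f2" "f1 \<noteq> f3" "f1 \<noteq> f4" "f2 \<noteq> f3" "f2 \<noteq> f4" "f3 \<noteq> f4" using dist Cf by auto
  \<comment> \<open>The number of the four boundaries that contain \<open>e\<close> is even, so it
    is never one.\<close>
  have s: "(e \<in> bE f1 \<longleftrightarrow> e \<in> bE f2) \<longleftrightarrow> (e \<in> bE f3 \<longleftrightarrow> e \<in> bE f4)" for e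
  proof -
    have "e \<in> sym_diff C1 C2 \<longleftrightarrow> e \<in> sym_diff C3 C4" unfolding eq ..
    then show ?thesis unfolding Cf by blast
  qed
  have all: "{f1, f2, f3, f4} = faces X G p \<gamma>"
  proof (rule faces_exhausted)
    show "even_f g" if "g \<in> {f1, f2, f3, f4}" for g using that f ev by blast
    fix g e assume g: "g \<in> {f1, f2, f3, f4}" and e: "e \<in> bE g"
    show "\<exists>f'\<in>{f1, f2, f3, f4}. f' \<noteq> g \<and> e \<in> bE f'" using g e s[of e] fd by auto
  qed simp_all
  have "{f1, f2, f3, f4} \<subseteq> F" using f by simp
  then have "faces X G p \<gamma> \<subseteq> F" unfolding all .
  moreover have "F \<subseteq> faces X G p \<gamma>" using ev unfolding even_face_def by blast
  ultimately show False using ne by simp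
qed

text \<open>\<open>clar_cover\<close> admits boundaries of all even faces and the count then insists
  on \<open>F\<close>, whereas \<open>clar_covers\<close> admits only \<open>F\<close> from the
  start. In both cases the face components are those in \<open>cyc\<close>; this uses that a single
  edge never bounds an even face, as its edge set is no circuit.\<close>

lemma clar_cover_count_eq:
  assumes ev: "\<And>f. f \<in> F \<Longrightarrow> even_f f" and res: "resonant_graph G (bE ` F)"
  shows "clar_cover_count X G p \<gamma> F k = card (resonant_graph.clar_covers G (bE ` F) k)"
proof -
  interpret resonant_graph G "bE ` F" by (rule res)
  let ?fbc = "face_boundary_components X G p \<gamma>"
  have cyc: "K \<in> cyc \<longleftrightarrow> (\<exists>f\<in>F. bcycle K f)" for K
    unfolding cyc_def using even_face_circuit(2)[OF ev] by (simp add: image_iff)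
  have fbc1: "graph_components S \<inter> cyc \<subseteq> ?fbc S" for S
    unfolding face_boundary_components_def using cyc ev by blast
  have "{S. clar_cover X G p \<gamma> S \<and> card (?fbc S) = k \<and> (\<forall>C\<in>?fbc S. \<exists>f\<in>F. bcycle C f)} = clar_covers k"
  proof (rule set_eqI)
    fix S
    show "S \<in> {S. clar_cover X G p \<gamma> S \<and> card (?fbc S) = k \<and> (\<forall>C\<in>?fbc S. \<exists>f\<in>F. bcycle C f)} \<longleftrightarrow> S \<in> clar_covers k"
    proof
      assume "S \<in> {S. clar_cover X G p \<gamma> S \<and> card (?fbc S) = k \<and> (\<forall>C\<in>?fbc S. \<exists>f\<in>F. bcycle C f)}"
      then have S: "clar_cover X G p \<gamma> S" "card (?fbc S) = k" "?fbc S \<subseteq> cyc" using cyc by auto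
      have "?fbc S = graph_components S \<inter> cyc" using fbc1[of S] S(3) unfolding face_boundary_components_def by blast
      then show "S \<in> clar_covers k" using S unfolding clar_covers_def clar_cover_def subgraph_of_def by auto
    next
      assume "S \<in> clar_covers k"
      then have S: "gverts S = gverts G" "gedges S \<subseteq> gedges G" "card (graph_components S \<inter> cyc) = k"
        and comp: "\<And>K. K \<in> graph_components S \<Longrightarrow> (\<exists>e\<in>gedges G. K = (e, {e})) \<or> K \<in> cyc"
        unfolding clar_covers_def by auto
      have "K \<in> cyc" if K: "K \<in> ?fbc S" for K
      proof (rule ccontr)
        assume n: "K \<notin> cyc"
        obtain f where f: "even_f f" "bcycle K f" and Kc: "K \<in> graph_components S"
          using K unfolding face_boundary_components_def by blast
        obtain e where e: "e \<in> gedges G" "K = (e, {e})" using comp[OF Kc] n by blast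
        have "circuit {e}" using even_face_circuit(1)[OF f(1)] boundary_edges_cycle[OF f(2)] e(2) by simp
        have "e \<noteq> {}" using edge_card[OF e(1)] by auto
        then obtain v where "v \<in> e" by blast
        from not_circuit_singleton[OF this] show False using \<open>circuit {e}\<close> by (rule notE)
      qed
      then have sub: "?fbc S \<subseteq> cyc" by blast
      then have "?fbc S = graph_components S \<inter> cyc" using fbc1[of S] unfolding face_boundary_components_def by blast
      moreover have "clar_cover X G p \<gamma> S" unfolding clar_cover_def subgraph_of_def
      proof (intro conjI ballI)
        show "gverts S \<subseteq> gverts G" "gverts S = gverts G" "gedges S \<subseteq> gedges G" using S by simp_all
        show "e \<subseteq> gverts S" if "e \<in> gedges S" for e unfolding S(1) using edge_verts(1) S(2) that by blast
        show "(\<exists>e\<in>gedges G. K = (e, {e})) \<or> K \<in> ?fbc S" if "K \<in> graph_components S" for K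
          using comp[OF that] fbc1[of S] that by blast
      qed
      ultimately show "S \<in> {S. clar_cover X G p \<gamma> S \<and> card (?fbc S) = k \<and> (\<forall>C\<in>?fbc S. \<exists>f\<in>F. bcycle C f)}"
        using S(3) sub cyc by (simp add: subset_iff)
    qed
  qed
  then show ?thesis unfolding clar_cover_count_def by simp
qed

end

theorem theorem1p3:
  fixes X :: "'a topology" and G :: "'v ugraph"
    and p :: "'v \<Rightarrow> 'a" and \<gamma> :: "'v set \<Rightarrow> real \<Rightarrow> 'a" and F :: "'a set set"
  assumes "closed_surface X"
    and "finite_simple_graph G"
    and "embedded_in X G p \<gamma>"
    and "\<forall>f\<in>F. even_face X G p \<gamma> f"
    and "F \<noteq> faces X G p \<gamma>"
  shows "zz_polynomial X G p \<gamma> F = cube_polynomial (resonance_graph X G p \<gamma> F)"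
proof -
  interpret E: embedded_graph X G p \<gamma> using assms(1-3) by unfold_locales
  have ev: "even_face X G p \<gamma> f" if "f \<in> F" for f using assms(4) that by blast
  have res: "resonant_graph G (boundary_edges X G p \<gamma> ` F)"
    by (rule E.resonant_graph_faces[OF ev assms(5)])
  interpret R: resonant_graph G "boundary_edges X G p \<gamma> ` F" by (rule res)
  have "R.resonance = resonance_graph X G p \<gamma> F"
    unfolding R.resonance_def resonance_graph_def by (simp only: image_iff)
  then have "clar_cover_count X G p \<gamma> F k = induced_cube_count (resonance_graph X G p \<gamma> F) k" for k
    using E.clar_cover_count_eq[OF ev res] R.card_clar_covers by simp
  \<comment> \<open>Equal counts for every index also give equal supports, over which the two sums
    range.\<close>
  then show ?thesis unfolding zz_polynomial_def cube_polynomial_def by simp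
qed

end
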